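(* Let $A$ and $B$ be two strongly commuting (not necessarily bounded) normal operators in a complex Hilbert space $H$. Then $\overline{AB}=\overline{BA}$, this operator is normal, and $$|\overline{BA}|=|\overline{AB}|=\overline{|A|\,|B|}=\overline{|B|\,|A|}.$$
   Context: Operators are linear, not necessarily bounded, defined on a subspace $D(T)$ of $H$. Products have natural domain $D(ST)=\{x\in D(T): Tx\in D(S)\}$, and $\overline{T}$ denotes the closure of a closable operator $T$. A densely defined operator $T$ is normal if it is closed and $TT^*=T^*T$. Two normal operators strongly commute if their spectral measures commute. For a closed densely defined operator $T$, $|T|$ denotes the unique positive self-adjoint square root of $T^*T$. Equality of operators includes equality of domains. *)

theory Defs
  imports "HOL-Analysis.Analysis"
begin

section \<open>Complex Hilbert spaces\<close>

text \<open>The inner product is linear in its first argument.\<close>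

class complex_hilbert_space = banach +
  fixes scaleC :: "complex \<Rightarrow> 'a \<Rightarrow> 'a" (infixr "*\<^sub>C" 75)
    and cinner :: "'a \<Rightarrow> 'a \<Rightarrow> complex"
  assumes scaleC_add_right: "c *\<^sub>C (x + y) = c *\<^sub>C x + c *\<^sub>C y"
    and scaleC_add_left: "(c + d) *\<^sub>C x = c *\<^sub>C x + d *\<^sub>C x"
    and scaleC_scaleC: "c *\<^sub>C d *\<^sub>C x = (c * d) *\<^sub>C x"
    and scaleC_one: "1 *\<^sub>C x = x"
    and scaleR_scaleC: "r *\<^sub>R x = complex_of_real r *\<^sub>C x"
    and cinner_add_left: "cinner (x + y) z = cinner x z + cinner y z"
    and cinner_scaleC_left: "cinner (c *\<^sub>C x) y = c * cinner x y"
    and cinner_commute: "cinner x y = cnj (cinner y x)"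
    and norm_eq_sqrt_cinner: "norm x = sqrt (Re (cinner x x))"


section \<open>Unbounded operators\<close>

text \<open>
  An operator in \<open>H\<close> is a partial map on \<open>H\<close> whose domain \<open>D(T)\<close> is \<^term>\<open>dom T\<close>, so equality
  of operators includes equality of domains, and the product \<open>ST\<close> with its natural domain
  is \<open>S \<circ>\<^sub>m T\<close>.
\<close>

definition linear_operator :: "('h::complex_hilbert_space \<rightharpoonup> 'h) \<Rightarrow> bool" where
  "linear_operator T \<longleftrightarrow>
     T 0 = Some 0 \<and>
     (\<forall>x y u v. T x = Some u \<longrightarrow> T y = Some v \<longrightarrow> T (x + y) = Some (u + v)) \<and>
     (\<forall>c x u. T x = Some u \<longrightarrow> T (c *\<^sub>C x) = Some (c *\<^sub>C u))"

definition densely_defined :: "('h::complex_hilbert_space \<rightharpoonup> 'h) \<Rightarrow> bool" where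
  "densely_defined T \<longleftrightarrow> closure (dom T) = UNIV"

definition closed_operator :: "('h::complex_hilbert_space \<rightharpoonup> 'h) \<Rightarrow> bool" where
  "closed_operator T \<longleftrightarrow> closed (Map.graph T)"

definition closable :: "('h::complex_hilbert_space \<rightharpoonup> 'h) \<Rightarrow> bool" where
  "closable T \<longleftrightarrow> (\<exists>S. Map.graph S = closure (Map.graph T))"

text \<open>Only meaningful for closable \<open>T\<close>.\<close>

definition operator_closure :: "('h::complex_hilbert_space \<rightharpoonup> 'h) \<Rightarrow> ('h \<rightharpoonup> 'h)" where
  "operator_closure T = (THE S. Map.graph S = closure (Map.graph T))"

text \<open>
  \<open>D(T\<^sup>*)\<close> consists of the \<open>y\<close> for which some \<open>z\<close> satisfies \<open>\<langle>T x, y\<rangle> = \<langle>x, z\<rangle>\<close> for all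
  \<open>x \<in> D(T)\<close>; this \<open>z = T\<^sup>* y\<close> is unique if \<open>T\<close> is densely defined.
\<close>

definition adjoint_operator :: "('h::complex_hilbert_space \<rightharpoonup> 'h) \<Rightarrow> ('h \<rightharpoonup> 'h)" where
  "adjoint_operator T y =
     (if \<exists>z. \<forall>x u. T x = Some u \<longrightarrow> cinner u y = cinner x z
      then Some (THE z. \<forall>x u. T x = Some u \<longrightarrow> cinner u y = cinner x z)
      else None)"

definition normal_operator :: "('h::complex_hilbert_space \<rightharpoonup> 'h) \<Rightarrow> bool" where
  "normal_operator T \<longleftrightarrow>
     linear_operator T \<and> densely_defined T \<and> closed_operator T \<and>
     T \<circ>\<^sub>m adjoint_operator T = adjoint_operator T \<circ>\<^sub>m T"

definition selfadjoint_operator :: "('h::complex_hilbert_space \<rightharpoonup> 'h) \<Rightarrow> bool" where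
  "selfadjoint_operator T \<longleftrightarrow>
     linear_operator T \<and> densely_defined T \<and> adjoint_operator T = T"

definition positive_operator :: "('h::complex_hilbert_space \<rightharpoonup> 'h) \<Rightarrow> bool" where
  "positive_operator T \<longleftrightarrow>
     (\<forall>x u. T x = Some u \<longrightarrow> cinner u x \<in> \<real> \<and> 0 \<le> Re (cinner u x))"

definition abs_operator :: "('h::complex_hilbert_space \<rightharpoonup> 'h) \<Rightarrow> ('h \<rightharpoonup> 'h)" where
  "abs_operator T =
     (THE S. selfadjoint_operator S \<and> positive_operator S \<and>
             S \<circ>\<^sub>m S = adjoint_operator T \<circ>\<^sub>m T)"


section \<open>Spectral measures and strong commutation\<close>

definition orthogonal_projection :: "('h::complex_hilbert_space \<Rightarrow> 'h) \<Rightarrow> bool" where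
  "orthogonal_projection P \<longleftrightarrow>
     (\<forall>x y. P (x + y) = P x + P y) \<and> (\<forall>c x. P (c *\<^sub>C x) = c *\<^sub>C P x) \<and>
     (\<forall>x. P (P x) = P x) \<and> (\<forall>x y. cinner (P x) y = cinner x (P y))"

text \<open>
  Projection-valued measures on the Borel sets of the complex plane, countably additive in
  the strong operator topology. The values of \<open>E\<close> on non-Borel sets are irrelevant.
\<close>

definition projection_valued_measure ::
    "(complex set \<Rightarrow> 'h::complex_hilbert_space \<Rightarrow> 'h) \<Rightarrow> bool" where
  "projection_valued_measure E \<longleftrightarrow>
     (\<forall>M \<in> sets borel. orthogonal_projection (E M)) \<and>
     (\<forall>x. E UNIV x = x) \<and>
     (\<forall>M::nat \<Rightarrow> complex set. range M \<subseteq> sets borel \<longrightarrow> disjoint_family M \<longrightarrow>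
        (\<forall>x. (\<lambda>n. E (M n) x) sums E (\<Union>n. M n) x))"

text \<open>The scalar measure \<open>M \<mapsto> \<langle>E(M) x, x\<rangle>\<close>.\<close>

definition scalar_measure ::
    "(complex set \<Rightarrow> 'h::complex_hilbert_space \<Rightarrow> 'h) \<Rightarrow> 'h \<Rightarrow> complex measure" where
  "scalar_measure E x =
     measure_of UNIV (sets borel) (\<lambda>M. ennreal (Re (cinner (E M x) x)))"

text \<open>
  \<open>E\<close> is the spectral measure of \<open>T\<close>, i.e. \<open>T = \<integral> z dE(z)\<close>: the domain of \<open>T\<close> is
  \<open>{x. \<integral> \<bar>z\<bar>\<^sup>2 d\<langle>E(z) x, x\<rangle> < \<infinity>}\<close>, and \<open>\<langle>T x, x\<rangle> = \<integral> z d\<langle>E(z) x, x\<rangle>\<close> for \<open>x\<close> in the domain,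
  which determines the linear operator \<open>T\<close> by polarization.
\<close>

definition is_spectral_measure ::
    "('h::complex_hilbert_space \<rightharpoonup> 'h) \<Rightarrow> (complex set \<Rightarrow> 'h \<Rightarrow> 'h) \<Rightarrow> bool" where
  "is_spectral_measure T E \<longleftrightarrow>
     projection_valued_measure E \<and>
     dom T = {x. (\<integral>\<^sup>+z. ennreal ((cmod z)\<^sup>2) \<partial>scalar_measure E x) < \<infinity>} \<and>
     (\<forall>x u. T x = Some u \<longrightarrow> cinner u x = (\<integral>z. z \<partial>scalar_measure E x))"

text \<open>
  By the spectral theorem a normal operator has a spectral measure, unique on the Borel sets;
  hence the existential quantifiers below refer to the spectral measures of \<open>A\<close> and \<open>B\<close>.
\<close>

definition strongly_commute ::
    "('h::complex_hilbert_space \<rightharpoonup> 'h) \<Rightarrow> ('h \<rightharpoonup> 'h) \<Rightarrow> bool" where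
  "strongly_commute A B \<longleftrightarrow>
     (\<exists>E F. is_spectral_measure A E \<and> is_spectral_measure B F \<and>
        (\<forall>M \<in> sets borel. \<forall>N \<in> sets borel. E M \<circ> F N = F N \<circ> E M))"

end

theory Submission
  imports Defs
begin

text \<open>
  The closures of \<open>AB\<close> and \<open>BA\<close> are both the joint spectral integral of \<open>zw\<close>, and those of
  \<open>\<bar>A\<bar> \<bar>B\<bar>\<close> and \<open>\<bar>B\<bar> \<bar>A\<bar>\<close> are both the joint spectral integral of \<open>\<bar>zw\<bar>\<close>, where \<open>z\<close> and \<open>w\<close> are
  the spectral variables of \<open>A\<close> and \<open>B\<close>. Since all functions involved are products
  \<open>f(z) g(w)\<close>, it is enough to multiply the functional calculi of the two given spectral measures \<open>E\<close>
  and \<open>F\<close>.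

  For bounded Borel \<open>f\<close> the operator \<open>\<Phi> f = \<integral> f dE\<close> is constructed from its quadratic form
  (\<open>represents_mult_exists\<close>); it is multiplicative and commutes with everything that commutes with
  \<open>E\<close>. Hence the operators \<open>joint f g\<close>, products of one calculus with the other, obey
  \<open>joint f g \<circ> joint f' g' = joint (f f') (g g')\<close>.

  An unbounded operator is represented by its parts on an increasing sequence of reducing subspaces,
  the ranges of projections \<open>Q n\<close>, where it is bounded. The whole operator \<open>T\<close> is the strong limit of
  the parts \<open>T n\<close>, and \<open>T x = y\<close> holds iff \<open>T n x = Q n y\<close> for all \<open>n\<close>
  (\<open>exhaustion.strong_limit_eq_Some_iff\<close>). From this description one reads off that \<open>T\<close> is closed and
  densely defined, that its adjoint is the limit of the adjoint parts, that the closure of a product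
  is the limit of the products of the parts (\<open>exhaustion.strong_limit_product_closure\<close>), and that a
  limit of normal parts is normal. With \<open>Q n = E (cball 0 n) F (cball 0 n)\<close>, both \<open>A\<close> and \<open>B\<close> are
  such limits (\<open>commuting_pvms.joint_operator_left\<close>, \<open>commuting_pvms.joint_operator_right\<close>), with
  parts given by the functions \<open>z\<close> and \<open>w\<close> cut off to balls.

  It remains to identify moduli. The family of \<open>\<bar>f(z)\<bar> \<bar>g(w)\<bar>\<close> yields a positive selfadjoint operator
  whose square is \<open>T\<^sup>* T\<close>. That no other operator has these properties, i.e. that the
  modulus of \<open>T\<close> is this operator, is \<open>exhaustion.positive_sqrt_unique\<close>. Its proof is elementary and
  does not use the spectral theorem: a second square root \<open>S\<close> of \<open>N\<^sup>2\<close> satisfies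
  \<open>(K + S) (S - N) = (S - N) (K - N)\<close>, and comparing norms after iterating this identity forces
  \<open>S = N\<close>.
\<close>

section \<open>Complex inner products\<close>

lemma Re_cinner_self_nonneg: "0 \<le> Re (cinner x x)" for x :: "'h::complex_hilbert_space"
  by (metis norm_eq_sqrt_cinner norm_ge_zero real_sqrt_ge_0_iff)

lemma cinner_self: "cinner x x = of_real ((norm x)\<^sup>2)" for x :: "'h::complex_hilbert_space"
proof (rule complex_eqI)
  show "Re (cinner x x) = Re (of_real ((norm x)\<^sup>2))"
    using Re_cinner_self_nonneg[of x] by (simp add: norm_eq_sqrt_cinner)
  have "Im (cinner x x) = Im (cnj (cinner x x))"
    using cinner_commute[of x x] by simp
  then show "Im (cinner x x) = Im (of_real ((norm x)\<^sup>2))" by simp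
qed

lemma cinner_add_right: "cinner x (y + z) = cinner x y + cinner x z"
  for x :: "'h::complex_hilbert_space"
  by (metis cinner_add_left cinner_commute complex_cnj_add)

lemma cinner_scaleC_right: "cinner x (c *\<^sub>C y) = cnj c * cinner x y"
  for x :: "'h::complex_hilbert_space"
  by (metis cinner_scaleC_left cinner_commute complex_cnj_mult)

lemma norm_scaleC: "norm (c *\<^sub>C x) = cmod c * norm x" for x :: "'h::complex_hilbert_space"
proof -
  have "of_real ((norm (c *\<^sub>C x))\<^sup>2) = c * cnj c * cinner x x"
    by (simp add: cinner_self[symmetric] cinner_scaleC_left cinner_scaleC_right del: of_real_power)
  also have "\<dots> = of_real ((cmod c * norm x)\<^sup>2)"
    by (simp add: complex_norm_square[symmetric] cinner_self power_mult_distrib)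
  finally have "(norm (c *\<^sub>C x))\<^sup>2 = (cmod c * norm x)\<^sup>2"
    using of_real_eq_iff by blast
  then show ?thesis by (simp add: power2_eq_iff_nonneg)
qed

lemma scaleC_minus_one: "(-1) *\<^sub>C x = - x" for x :: "'h::complex_hilbert_space"
  using scaleR_scaleC[of "-1" x] by simp

lemma norm_square_eq_Re_cinner: "(norm x)\<^sup>2 = Re (cinner x x)"
  for x :: "'h::complex_hilbert_space"
  unfolding cinner_self by simp

lemma norm_add_square:
  "(norm (x + y))\<^sup>2 = (norm x)\<^sup>2 + (norm y)\<^sup>2 + 2 * Re (cinner x y)"
  for x :: "'h::complex_hilbert_space"
proof -
  have "Re (cinner y x) = Re (cinner x y)"
    by (subst cinner_commute) simp
  then show ?thesis
    unfolding norm_square_eq_Re_cinner by (simp add: cinner_add_left cinner_add_right)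
qed

lemma cinner_cauchy_schwarz: "cmod (cinner x y) \<le> norm x * norm y"
  for x :: "'h::complex_hilbert_space"
proof (cases "y = 0")
  case True
  have "cinner x (0 + 0) = cinner x 0 + cinner x 0" by (rule cinner_add_right)
  then show ?thesis using True by simp
next
  case False
  define t where "t = - (cinner x y / of_real ((norm y)\<^sup>2))"
  have n: "(norm y)\<^sup>2 > 0" using False by simp
  have "cinner x (t *\<^sub>C y) = - (cinner x y * cnj (cinner x y) / of_real ((norm y)\<^sup>2))"
    by (simp add: t_def cinner_scaleC_right mult.commute)
  also have "\<dots> = of_real (- ((cmod (cinner x y))\<^sup>2 / (norm y)\<^sup>2))"
    unfolding complex_norm_square[symmetric] by simp
  finally have "Re (cinner x (t *\<^sub>C y)) = - ((cmod (cinner x y))\<^sup>2 / (norm y)\<^sup>2)"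
    by (metis Re_complex_of_real)
  moreover have "norm (t *\<^sub>C y) = cmod (cinner x y) / norm y"
    using False by (simp add: norm_scaleC t_def norm_divide norm_mult power2_eq_square)
  then have "(norm (t *\<^sub>C y))\<^sup>2 = (cmod (cinner x y))\<^sup>2 / (norm y)\<^sup>2"
    by (simp add: power_divide)
  ultimately have "0 \<le> (norm x)\<^sup>2 - (cmod (cinner x y))\<^sup>2 / (norm y)\<^sup>2"
    using norm_add_square[of x "t *\<^sub>C y"] zero_le_power2[of "norm (x + t *\<^sub>C y)"] by linarith
  then have "(cmod (cinner x y))\<^sup>2 \<le> (norm x * norm y)\<^sup>2"
    using n by (simp add: field_simps power_mult_distrib)
  then show ?thesis by (rule power2_le_imp_le) simp
qed

lemma bounded_bilinear_cinner:
  "bounded_bilinear (cinner :: 'h::complex_hilbert_space \<Rightarrow> 'h \<Rightarrow> complex)"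
proof
  show "\<exists>K. \<forall>a b :: 'h. norm (cinner a b) \<le> norm a * norm b * K"
    by (rule exI[of _ 1]) (simp add: cinner_cauchy_schwarz)
qed (simp_all add: cinner_add_left cinner_add_right scaleR_scaleC cinner_scaleC_left
    cinner_scaleC_right scaleR_conv_of_real)

interpretation cinner: bounded_bilinear "cinner :: 'h::complex_hilbert_space \<Rightarrow> 'h \<Rightarrow> complex"
  by (rule bounded_bilinear_cinner)

lemma cinner_ext: "(\<And>w. cinner w x = cinner w y) \<Longrightarrow> x = y" for x y :: "'h::complex_hilbert_space"
proof -
  assume "\<And>w. cinner w x = cinner w y"
  then have "cinner (x - y) (x - y) = 0" by (simp add: cinner.diff_right)
  then show "x = y" by (simp add: cinner_self)
qed

lemma orthogonal_dense_imp_zero: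
  fixes u :: "'h::complex_hilbert_space"
  assumes "closure D = UNIV" and "\<And>y. y \<in> D \<Longrightarrow> cinner u y = 0"
  shows "u = 0"
proof -
  obtain y where y: "\<And>n. y n \<in> D" "y \<longlonglongrightarrow> u"
    using assms(1) closure_sequential[of u D] by auto
  have "(\<lambda>n. cinner u (y n)) \<longlonglongrightarrow> cinner u u"
    by (intro cinner.tendsto tendsto_const y)
  moreover have "(\<lambda>n. cinner u (y n)) = (\<lambda>n. 0)"
    using y(1) assms(2) by auto
  ultimately have "cinner u u = 0" by (metis LIMSEQ_unique tendsto_const)
  then show ?thesis by (simp add: cinner_self)
qed

text \<open>
  The polarization identity, phrased for vectors and their images so that it applies to a partially
  defined operator: \<open>u\<close> and \<open>v\<close> are the images of \<open>x\<close> and \<open>y\<close>, and the quadratic form is assumed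
  to vanish at \<open>x\<close>, \<open>y\<close>, \<open>x + y\<close> and \<open>x + \<i>y\<close> only.
\<close>

lemma polarization_zero:
  fixes u v x y :: "'h::complex_hilbert_space"
  assumes "cinner u x = 0" "cinner v y = 0" "cinner (u + v) (x + y) = 0"
    and "cinner (u + \<i> *\<^sub>C v) (x + \<i> *\<^sub>C y) = 0"
  shows "cinner u y = 0"
proof -
  have 1: "cinner u y + cinner v x = 0"
    using assms by (simp add: cinner_add_left cinner_add_right add.commute)
  have "- \<i> * cinner u y + \<i> * cinner v x = 0"
    using assms by (simp add: cinner_add_left cinner_add_right cinner_scaleC_left cinner_scaleC_right)
  then have "\<i> * (cinner v x - cinner u y) = 0" by (simp add: algebra_simps)
  then have 2: "cinner v x = cinner u y" by simp
  show ?thesis using 1 2 by simp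
qed

section \<open>Bounded operators\<close>

definition bounded_clinear :: "('h::complex_hilbert_space \<Rightarrow> 'h) \<Rightarrow> bool" where
  "bounded_clinear T \<longleftrightarrow> bounded_linear T \<and> (\<forall>c x. T (c *\<^sub>C x) = c *\<^sub>C T x)"

definition adjoint_pair :: "('h::complex_hilbert_space \<Rightarrow> 'h) \<Rightarrow> ('h \<Rightarrow> 'h) \<Rightarrow> bool" where
  "adjoint_pair T S \<longleftrightarrow> (\<forall>x y. cinner (T x) y = cinner x (S y))"

lemma adjoint_pairD: "adjoint_pair T S \<Longrightarrow> cinner (T x) y = cinner x (S y)"
  by (simp add: adjoint_pair_def)

lemma adjoint_pair_sym: "adjoint_pair T S \<Longrightarrow> adjoint_pair S T"
  unfolding adjoint_pair_def by (metis cinner_commute)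

lemma adjoint_pair_compose:
  "adjoint_pair T T' \<Longrightarrow> adjoint_pair S S' \<Longrightarrow> adjoint_pair (\<lambda>x. T (S x)) (\<lambda>y. S' (T' y))"
  by (simp add: adjoint_pair_def)

lemma bounded_clinearI:
  assumes "\<And>x y. T (x + y) = T x + T y" "\<And>c x. T (c *\<^sub>C x) = c *\<^sub>C T x"
    "\<And>x. norm (T x) \<le> norm x * K"
  shows "bounded_clinear T"
  unfolding bounded_clinear_def
  by (auto intro!: bounded_linear_intro[where K=K] simp: assms scaleR_scaleC)

lemma bounded_clinear_linear: "bounded_clinear T \<Longrightarrow> bounded_linear T"
  by (simp add: bounded_clinear_def)

lemma bounded_clinear_scaleC: "bounded_clinear T \<Longrightarrow> T (c *\<^sub>C x) = c *\<^sub>C T x"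
  by (simp add: bounded_clinear_def)

lemmas bounded_clinear_add = bounded_clinear_linear[THEN bounded_linear.linear, THEN linear_add]
lemmas bounded_clinear_diff = bounded_clinear_linear[THEN bounded_linear.linear, THEN linear_diff]
lemmas bounded_clinear_zero = bounded_clinear_linear[THEN bounded_linear.linear, THEN linear_0]
lemmas bounded_clinear_tendsto = bounded_clinear_linear[THEN bounded_linear.tendsto]

lemma bounded_clinear_compose:
  "bounded_clinear T \<Longrightarrow> bounded_clinear S \<Longrightarrow> bounded_clinear (\<lambda>x. T (S x))"
  unfolding bounded_clinear_def o_def by (auto intro: bounded_linear_compose)

lemma bounded_clinear_sum:
  "bounded_clinear T \<Longrightarrow> bounded_clinear S \<Longrightarrow> bounded_clinear (\<lambda>x. T x + S x)"
  unfolding bounded_clinear_def by (auto intro: bounded_linear_add simp: scaleC_add_right)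

lemma bounded_clinear_scale:
  assumes "bounded_clinear T"
  shows "bounded_clinear (\<lambda>x. c *\<^sub>C T x)"
proof -
  obtain K where K: "\<And>x. norm (T x) \<le> norm x * K"
    using bounded_linear.bounded[OF bounded_clinear_linear[OF assms]] by blast
  have "norm (c *\<^sub>C T x) \<le> norm x * (K * cmod c)" for x
    using mult_left_mono[OF K[of x], of "cmod c"] by (simp add: norm_scaleC mult_ac)
  then show ?thesis
    by (intro bounded_clinearI[where K="K * cmod c"])
      (simp_all add: bounded_clinear_add[OF assms] bounded_clinear_scaleC[OF assms]
        scaleC_add_right scaleC_scaleC mult.commute)
qed

lemma bounded_clinear_eqI:
  assumes T: "bounded_clinear T" and S: "bounded_clinear S"
    and eq: "\<And>x. cinner (T x) x = cinner (S x) x"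
  shows "T = S"
proof
  fix x
  have "cinner (T x - S x) y = 0" for y
  proof (rule polarization_zero)
    have "T (x + c *\<^sub>C y) - S (x + c *\<^sub>C y) = (T x - S x) + c *\<^sub>C (T y - S y)" for c
      using scaleC_add_right[of c "T y - S y" "S y"]
      by (simp add: bounded_clinear_add T S bounded_clinear_scaleC algebra_simps)
    note d = this
    show "cinner (T x - S x) x = 0" "cinner (T y - S y) y = 0"
      by (simp_all add: cinner.diff_left eq)
    show "cinner ((T x - S x) + (T y - S y)) (x + y) = 0"
      using d[of 1, symmetric] by (simp add: scaleC_one cinner.diff_left eq)
    show "cinner ((T x - S x) + \<i> *\<^sub>C (T y - S y)) (x + \<i> *\<^sub>C y) = 0"
      by (simp add: d[symmetric] cinner.diff_left eq)
  qed
  from this[of "T x - S x"] show "T x = S x" by (simp add: cinner_self)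
qed

lemma adjoint_pairI_diagonal:
  assumes T: "bounded_clinear T" and S: "bounded_clinear S"
    and eq: "\<And>x. cinner (T x) x = cinner x (S x)"
  shows "adjoint_pair T S"
  unfolding adjoint_pair_def
proof (intro allI)
  fix x y
  have "cinner (T x) y + cinner (T y) x = cinner x (S y) + cinner y (S x)"
    using eq[of "x + y"] eq[of x] eq[of y]
    by (simp add: bounded_clinear_add[OF T] bounded_clinear_add[OF S] cinner_add_left cinner_add_right
        algebra_simps)
  moreover have "\<i> * (cinner (T y) x - cinner (T x) y) = \<i> * (cinner y (S x) - cinner x (S y))"
    using eq[of "x + \<i> *\<^sub>C y"] eq[of x] eq[of y]
    by (simp add: bounded_clinear_add[OF T] bounded_clinear_add[OF S] cinner_add_left cinner_add_right
        bounded_clinear_scaleC[OF T] bounded_clinear_scaleC[OF S]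
        cinner_scaleC_left cinner_scaleC_right algebra_simps)
  then have "cinner (T y) x - cinner (T x) y = cinner y (S x) - cinner x (S y)"
    by simp
  ultimately have "2 * cinner (T x) y = 2 * cinner x (S y)"
    by algebra
  then show "cinner (T x) y = cinner x (S y)" by simp
qed

lemma orthogonal_projection_selfadjoint: "orthogonal_projection P \<Longrightarrow> adjoint_pair P P"
  by (simp add: orthogonal_projection_def adjoint_pair_def)

text \<open>
  The scalar measure of a projection-valued measure is defined by \<open>\<langle>E(M) x, x\<rangle>\<close>; this identity makes
  it visibly real and nonnegative.
\<close>

lemma orthogonal_projection_norm_square:
  assumes "orthogonal_projection P"
  shows "cinner (P x) x = of_real ((norm (P x))\<^sup>2)"
  using assms cinner_self[of "P x"] by (simp add: orthogonal_projection_def)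

lemma orthogonal_projection_norm_le:
  assumes "orthogonal_projection P"
  shows "norm (P x) \<le> norm x"
proof -
  have "norm (P x) * norm (P x) \<le> norm (P x) * norm x"
    using cinner_cauchy_schwarz[of "P x" x]
    unfolding orthogonal_projection_norm_square[OF assms]
    by (simp add: norm_power power2_eq_square norm_mult)
  then show ?thesis
    by (cases "norm (P x) = 0") (auto simp: mult_le_cancel_left)
qed

lemma orthogonal_projection_bounded_clinear:
  assumes "orthogonal_projection P"
  shows "bounded_clinear P"
  using assms orthogonal_projection_norm_le[OF assms]
  by (intro bounded_clinearI[where K=1]) (auto simp: orthogonal_projection_def)

section \<open>Projection-valued measures\<close>

locale pvm =
  fixes E :: "complex set \<Rightarrow> 'h::complex_hilbert_space \<Rightarrow> 'h"
  assumes pvm: "projection_valued_measure E"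
begin

lemma projection: "M \<in> sets borel \<Longrightarrow> orthogonal_projection (E M)"
  using pvm by (simp add: projection_valued_measure_def)

lemma E_UNIV: "E UNIV x = x"
  using pvm by (simp add: projection_valued_measure_def)

lemma E_sums:
  "range M \<subseteq> sets borel \<Longrightarrow> disjoint_family M \<Longrightarrow> (\<lambda>n::nat. E (M n) x) sums E (\<Union>n. M n) x"
  using pvm by (simp add: projection_valued_measure_def)

lemmas E_bounded_clinear = projection[THEN orthogonal_projection_bounded_clinear]
lemmas E_selfadjoint = projection[THEN orthogonal_projection_selfadjoint]
lemmas E_norm_le = projection[THEN orthogonal_projection_norm_le]
lemmas E_cinner_self = projection[THEN orthogonal_projection_norm_square]
lemmas E_add = E_bounded_clinear[THEN bounded_clinear_add]
lemmas E_scaleC = E_bounded_clinear[THEN bounded_clinear_scaleC]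

lemma E_idem: "M \<in> sets borel \<Longrightarrow> E M (E M x) = E M x"
  using projection[of M] by (simp add: orthogonal_projection_def)

lemma E_empty: "E {} x = 0"
proof -
  have "(\<lambda>n::nat. E {} x) sums E (\<Union>n::nat. {}) x"
    by (rule E_sums) (auto simp: disjoint_family_on_def)
  then have "summable (\<lambda>n::nat. E {} x)" by (rule sums_summable)
  then show ?thesis by (simp add: summable_const_iff)
qed

lemma E_Un_disjoint:
  assumes "M \<in> sets borel" "N \<in> sets borel" "M \<inter> N = {}"
  shows "E (M \<union> N) x = E M x + E N x"
proof -
  have "(\<lambda>n. E (binaryset M N n) x) sums E (\<Union>n. binaryset M N n) x"
    using assms by (intro E_sums) (auto simp: range_binaryset_eq disjoint_family_on_def binaryset_def)
  moreover have "(\<lambda>n. E (binaryset M N n) x) sums (E M x + E N x)"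
    using binaryset_sums[of "\<lambda>K. E K x" M N] by (simp add: E_empty)
  ultimately show ?thesis using sums_unique2 by (simp add: UN_binaryset_eq)
qed

text \<open>
  A sum of projections is a projection only if their ranges are orthogonal: at a vector \<open>v\<close> fixed by
  \<open>E N\<close> one has \<open>\<parallel>E (M \<union> N) v\<parallel>\<^sup>2 = \<parallel>E M v\<parallel>\<^sup>2 + \<parallel>v\<parallel>\<^sup>2\<close>, while projections do not increase the norm.
\<close>

lemma E_disjoint_zero:
  assumes "M \<in> sets borel" "N \<in> sets borel" "M \<inter> N = {}"
  shows "E M (E N x) = 0"
proof -
  let ?R = "E (M \<union> N)"
  have R: "?R (E N x) = E M (E N x) + E N x"
    using E_Un_disjoint[OF assms] E_idem[OF assms(2)] by simp
  have MN: "M \<union> N \<in> sets borel" using assms by simp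
  have "cinner (?R (E N x)) (E N x) = cinner (E M (E N x)) (E N x) + cinner (E N x) (E N x)"
    by (simp add: R cinner_add_left)
  then have "complex_of_real ((norm (?R (E N x)))\<^sup>2)
      = of_real ((norm (E M (E N x)))\<^sup>2 + (norm (E N x))\<^sup>2)"
    by (simp only: E_cinner_self[OF MN] E_cinner_self[OF assms(1)] cinner_self of_real_add)
  then have "(norm (?R (E N x)))\<^sup>2 = (norm (E M (E N x)))\<^sup>2 + (norm (E N x))\<^sup>2"
    using of_real_eq_iff by blast
  moreover have "(norm (?R (E N x)))\<^sup>2 \<le> (norm (E N x))\<^sup>2"
    by (intro power_mono E_norm_le MN norm_ge_zero)
  ultimately have "(norm (E M (E N x)))\<^sup>2 \<le> 0" by linarith
  then show ?thesis by simp
qed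

lemma E_Int:
  assumes "M \<in> sets borel" "N \<in> sets borel"
  shows "E M (E N x) = E (M \<inter> N) x"
proof -
  have sets: "M \<inter> N \<in> sets borel" "M - N \<in> sets borel" "N - M \<in> sets borel"
    using assms by auto
  have split: "M = (M \<inter> N) \<union> (M - N)" "N = (M \<inter> N) \<union> (N - M)" by auto
  have "E N x = E (M \<inter> N) x + E (N - M) x"
    by (subst split(2), rule E_Un_disjoint) (use sets in auto)
  then have "E M (E N x) = E M (E (M \<inter> N) x)"
    using E_disjoint_zero[of M "N - M" x] assms sets by (simp add: E_add)
  also have "\<dots> = E (M \<inter> N) (E (M \<inter> N) x) + E (M - N) (E (M \<inter> N) x)"
    by (subst split(1), rule E_Un_disjoint) (use sets in auto)
  also have "E (M - N) (E (M \<inter> N) x) = 0"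
    by (rule E_disjoint_zero) (use sets in auto)
  finally show ?thesis using sets by (simp add: E_idem)
qed

lemma E_Compl: "M \<in> sets borel \<Longrightarrow> E (- M) x = x - E M x"
  using E_Un_disjoint[of M "- M" x] by (simp add: E_UNIV algebra_simps)

abbreviation \<mu> :: "'h \<Rightarrow> complex measure" where "\<mu> \<equiv> scalar_measure E"

lemma space_mu [simp]: "space (\<mu> x) = UNIV"
  by (simp add: scalar_measure_def)

lemma sets_mu [simp, measurable_cong]: "sets (\<mu> x) = sets borel"
  using sets.sigma_sets_eq[of "borel :: complex measure"]
  by (simp add: scalar_measure_def sets_measure_of)

lemma emeasure_mu:
  assumes "M \<in> sets borel"
  shows "emeasure (\<mu> x) M = ennreal ((norm (E M x))\<^sup>2)"
proof -
  let ?f = "\<lambda>M. ennreal (Re (cinner (E M x) x))"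
  have "countably_additive (sets borel) ?f"
    unfolding countably_additive_def
  proof (intro allI impI)
    fix M :: "nat \<Rightarrow> complex set"
    assume M: "range M \<subseteq> sets borel" "disjoint_family M"
    have "(\<lambda>n. Re (cinner (E (M n) x) x)) sums Re (cinner (E (\<Union>n. M n) x) x)"
      using sums_Re[OF bounded_linear.sums[OF cinner.bounded_linear_left E_sums[OF M]]] .
    then show "(\<Sum>n. ?f (M n)) = ?f (\<Union>n. M n)"
      using M by (intro suminf_ennreal_eq) (auto simp: E_cinner_self range_subsetD)
  qed
  moreover have "positive (sets borel) ?f"
    by (simp add: positive_def E_empty cinner.zero_left)
  ultimately have "emeasure (\<mu> x) M = ?f M"
    using assms sets.sigma_sets_eq[of "borel :: complex measure"]
    by (intro emeasure_measure_of[OF scalar_measure_def]) (auto simp: sets_measure_of)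
  then show ?thesis using E_cinner_self[OF assms] by simp
qed

lemma finite_measure_mu: "finite_measure (\<mu> x)"
  by (rule finite_measureI) (simp add: emeasure_mu)

lemma measure_mu: "M \<in> sets borel \<Longrightarrow> measure (\<mu> x) M = (norm (E M x))\<^sup>2"
  by (simp add: measure_def emeasure_mu)

text \<open>
  Multiplicativity of \<open>E\<close> turns the projection \<open>E M\<close> of a vector into the restriction of its scalar
  measure to \<open>M\<close>. This is how products of operators become products of functions.
\<close>

lemma mu_projection:
  assumes M: "M \<in> sets borel"
  shows "\<mu> (E M x) = density (\<mu> x) (\<lambda>z. ennreal (indicator M z))"
proof (rule measure_eqI)
  fix N assume "N \<in> sets (\<mu> (E M x))"
  then have N: "N \<in> sets borel" by simp
  have "emeasure (density (\<mu> x) (\<lambda>z. ennreal (indicator M z))) N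
      = (\<integral>\<^sup>+z. ennreal (indicator M z) * indicator N z \<partial>\<mu> x)"
    using M N by (intro emeasure_density) auto
  also have "\<dots> = (\<integral>\<^sup>+z. indicator (N \<inter> M) z \<partial>\<mu> x)"
    by (intro nn_integral_cong) (auto split: split_indicator)
  also have "\<dots> = emeasure (\<mu> x) (N \<inter> M)"
    using M N by (intro nn_integral_indicator) auto
  finally show "emeasure (\<mu> (E M x)) N = emeasure (density (\<mu> x) (\<lambda>z. ennreal (indicator M z))) N"
    using M N by (simp add: emeasure_mu E_Int)
qed simp

end

section \<open>Bounded Borel functional calculus\<close>

definition bounded_borel :: "(complex \<Rightarrow> complex) \<Rightarrow> bool" where
  "bounded_borel f \<longleftrightarrow> f \<in> borel_measurable borel \<and> (\<exists>C. \<forall>z. cmod (f z) \<le> C)"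

lemma bounded_borel_measurable: "bounded_borel f \<Longrightarrow> f \<in> borel_measurable borel"
  by (simp add: bounded_borel_def)

lemma bounded_borelI:
  "f \<in> borel_measurable borel \<Longrightarrow> (\<And>z. cmod (f z) \<le> C) \<Longrightarrow> bounded_borel f"
  by (auto simp: bounded_borel_def)

lemma bounded_borel_indicator: "M \<in> sets borel \<Longrightarrow> bounded_borel (indicator M)"
  by (rule bounded_borelI[where C=1]) (auto split: split_indicator)

lemma bounded_borel_const: "bounded_borel (\<lambda>z. c)"
  by (rule bounded_borelI) auto

lemma bounded_borel_mult:
  assumes "bounded_borel f" "bounded_borel g"
  shows "bounded_borel (\<lambda>z. f z * g z)"
proof -
  obtain C D where C: "\<And>z. cmod (f z) \<le> C" and D: "\<And>z. cmod (g z) \<le> D"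
    using assms unfolding bounded_borel_def by blast
  have "cmod (f z * g z) \<le> C * D" for z
    using mult_mono[OF C D] order_trans[OF norm_ge_zero C] by (simp add: norm_mult)
  then show ?thesis
    using assms by (intro bounded_borelI) (auto simp: bounded_borel_def)
qed

lemma bounded_borel_add:
  assumes "bounded_borel f" "bounded_borel g"
  shows "bounded_borel (\<lambda>z. f z + g z)"
proof -
  obtain C D where C: "\<And>z. cmod (f z) \<le> C" and D: "\<And>z. cmod (g z) \<le> D"
    using assms unfolding bounded_borel_def by blast
  have "cmod (f z + g z) \<le> C + D" for z
    using norm_triangle_le[OF add_mono[OF C D]] .
  then show ?thesis
    using assms by (intro bounded_borelI) (auto simp: bounded_borel_def)
qed

lemma bounded_borel_cnj: "bounded_borel f \<Longrightarrow> bounded_borel (\<lambda>z. cnj (f z))"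
  unfolding bounded_borel_def
  using measurable_compose[OF _ borel_measurable_continuous_onI[of cnj]]
  by (auto intro: continuous_intros)

lemma bounded_borel_dominated:
  "bounded_borel g \<Longrightarrow> f \<in> borel_measurable borel \<Longrightarrow> (\<And>z. cmod (f z) \<le> cmod (g z)) \<Longrightarrow> bounded_borel f"
  unfolding bounded_borel_def by (meson order_trans)

context pvm
begin

lemma bounded_borel_integrable:
  assumes "bounded_borel f"
  shows "integrable (\<mu> x) f"
proof -
  obtain C where "\<And>z. cmod (f z) \<le> C" using assms unfolding bounded_borel_def by blast
  then show ?thesis
    using assms by (intro finite_measure.integrable_const_bound[OF finite_measure_mu, where B=C])
      (auto simp: bounded_borel_def)
qed

lemma integral_mu_projection:
  assumes "bounded_borel f" "M \<in> sets borel"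
  shows "(\<integral>z. f z \<partial>\<mu> (E M x)) = (\<integral>z. f z * indicator M z \<partial>\<mu> x)"
proof -
  have "(\<integral>z. f z \<partial>\<mu> (E M x)) = (\<integral>z. indicator M z *\<^sub>R f z \<partial>\<mu> x)"
    unfolding mu_projection[OF assms(2)] using assms
    by (intro integral_density) (auto simp: bounded_borel_def)
  also have "\<dots> = (\<integral>z. f z * indicator M z \<partial>\<mu> x)"
    by (intro Bochner_Integration.integral_cong) (auto split: split_indicator)
  finally show ?thesis .
qed

lemma integral_mu_split:
  assumes "bounded_borel f" "M \<in> sets borel"
  shows "(\<integral>z. f z \<partial>\<mu> x) = (\<integral>z. f z \<partial>\<mu> (E M x)) + (\<integral>z. f z \<partial>\<mu> (E (- M) x))"
proof -
  have M': "- M \<in> sets borel" using assms(2) by simp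
  note int = bounded_borel_integrable[OF bounded_borel_mult[OF assms(1) bounded_borel_indicator]]
  have "(\<integral>z. f z \<partial>\<mu> (E M x)) + (\<integral>z. f z \<partial>\<mu> (E (- M) x))
      = (\<integral>z. f z * indicator M z + f z * indicator (- M) z \<partial>\<mu> x)"
    unfolding integral_mu_projection[OF assms] integral_mu_projection[OF assms(1) M']
    using Bochner_Integration.integral_add[OF int[OF assms(2)] int[OF M']] by simp
  also have "\<dots> = (\<integral>z. f z \<partial>\<mu> x)"
    by (intro Bochner_Integration.integral_cong) (auto split: split_indicator)
  finally show ?thesis by simp
qed

text \<open>
  The bounded operator \<open>\<integral> f dE\<close> is characterised by its quadratic form. This avoids polarized complex
  measures and the Riesz representation theorem; existence is shown by approximation below.
\<close>

definition represents :: "(complex \<Rightarrow> complex) \<Rightarrow> ('h \<Rightarrow> 'h) \<Rightarrow> bool" where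
  "represents f T \<longleftrightarrow> bounded_clinear T \<and> (\<forall>x. cinner (T x) x = (\<integral>z. f z \<partial>\<mu> x))"

lemma represents_bounded_clinear: "represents f T \<Longrightarrow> bounded_clinear T"
  by (simp add: represents_def)

lemma represents_cinner: "represents f T \<Longrightarrow> cinner (T x) x = (\<integral>z. f z \<partial>\<mu> x)"
  by (simp add: represents_def)

lemma represents_unique: "represents f T \<Longrightarrow> represents f S \<Longrightarrow> T = S"
  by (auto simp: represents_def intro: bounded_clinear_eqI)

lemma represents_add:
  assumes "bounded_borel f" "bounded_borel g" "represents f T" "represents g S"
  shows "represents (\<lambda>z. f z + g z) (\<lambda>x. T x + S x)"
  using assms bounded_borel_integrable[OF assms(1)] bounded_borel_integrable[OF assms(2)]
  by (simp add: represents_def bounded_clinear_sum cinner_add_left)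

lemma represents_scale:
  assumes "represents f T"
  shows "represents (\<lambda>z. c * f z) (\<lambda>x. c *\<^sub>C T x)"
  using assms by (simp add: represents_def bounded_clinear_scale cinner_scaleC_left)

lemma represents_indicator:
  assumes "M \<in> sets borel"
  shows "represents (indicator M) (E M)"
  unfolding represents_def
proof (intro conjI allI E_bounded_clinear[OF assms])
  fix x
  have "(\<integral>z. indicator M z \<partial>\<mu> x) = (\<integral>z. complex_of_real (indicator M z) \<partial>\<mu> x)"
    by (intro Bochner_Integration.integral_cong) (auto split: split_indicator)
  also have "\<dots> = of_real ((norm (E M x))\<^sup>2)"
    using assms by (simp add: measure_mu)
  finally show "cinner (E M x) x = (\<integral>z. indicator M z \<partial>\<mu> x)"
    by (simp add: E_cinner_self[OF assms])
qed

text \<open>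
  The scalar measure of \<open>E M x + E (- M) y\<close> is the sum of those of its two parts, so the
  quadratic form of \<open>T\<close> has no cross terms between the ranges of \<open>E M\<close> and \<open>E (- M)\<close>. Replacing
  \<open>y\<close> by \<open>\<i>y\<close> shows that each of the two cross terms vanishes, i.e. \<open>T\<close> leaves both ranges invariant.
\<close>

lemma represents_commute:
  assumes f: "bounded_borel f" and T: "represents f T" and M: "M \<in> sets borel"
  shows "T (E M x) = E M (T x)"
proof -
  note lin = represents_bounded_clinear[OF T]
  have M': "- M \<in> sets borel" using M by simp
  have proj: "E M (E M x + E (- M) y) = E M x" "E (- M) (E M x + E (- M) y) = E (- M) y" for x y
    using E_disjoint_zero[OF M M'] E_disjoint_zero[OF M' M]
    by (simp_all add: E_add M M' E_idem)
  have cross: "cinner (T (E M x)) (E (- M) y) + cinner (T (E (- M) y)) (E M x) = 0" for x y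
  proof -
    let ?w = "E M x + E (- M) y"
    have "cinner (T ?w) ?w = cinner (T (E M x)) (E M x) + cinner (T (E (- M) y)) (E (- M) y)"
      using integral_mu_split[OF f M, of ?w] by (simp add: represents_cinner[OF T] proj)
    then show ?thesis
      by (simp add: bounded_clinear_add[OF lin] cinner_add_left cinner_add_right algebra_simps)
  qed
  have zero: "cinner (T (E M x)) (E (- M) y) = 0" for x y
  proof -
    have "\<i> * (cinner (T (E (- M) y)) (E M x) - cinner (T (E M x)) (E (- M) y)) = 0"
      using cross[of x "\<i> *\<^sub>C y"]
      by (simp add: E_scaleC M' bounded_clinear_scaleC[OF lin] cinner_scaleC_left
          cinner_scaleC_right algebra_simps)
    then have "cinner (T (E (- M) y)) (E M x) = cinner (T (E M x)) (E (- M) y)" by simp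
    with cross[of x y] show ?thesis by simp
  qed
  have 1: "E (- M) (T (E M x)) = 0"
  proof (rule cinner_ext)
    fix w
    have "cinner (T (E M x)) (E (- M) w) = 0" by (rule zero)
    then have "cinner (E (- M) w) (T (E M x)) = 0"
      by (subst cinner_commute) simp
    then show "cinner w (E (- M) (T (E M x))) = cinner w 0"
      by (simp add: adjoint_pairD[OF E_selfadjoint[OF M'], symmetric] cinner.zero_right)
  qed
  have 2: "E M (T (E (- M) x)) = 0"
  proof (rule cinner_ext)
    fix w
    have "cinner (T (E (- M) x)) (E M w) = 0" using cross[of w x] zero[of w x] by simp
    then have "cinner (E M w) (T (E (- M) x)) = 0"
      by (subst cinner_commute) simp
    then show "cinner w (E M (T (E (- M) x))) = cinner w 0"
      by (simp add: adjoint_pairD[OF E_selfadjoint[OF M], symmetric] cinner.zero_right)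
  qed
  have "E M (T x) = E M (T (E M x + E (- M) x))"
    by (simp add: E_Compl[OF M])
  also have "\<dots> = E M (T (E M x))"
    by (simp add: bounded_clinear_add[OF lin] E_add[OF M] 2)
  also have "\<dots> = T (E M x)"
    using 1 by (simp add: E_Compl[OF M])
  finally show ?thesis by simp
qed

lemma represents_times_indicator:
  assumes f: "bounded_borel f" and T: "represents f T" and M: "M \<in> sets borel"
  shows "represents (\<lambda>z. f z * indicator M z) (\<lambda>x. T (E M x))"
  unfolding represents_def
proof (intro conjI allI)
  show "bounded_clinear (\<lambda>x. T (E M x))"
    by (rule bounded_clinear_compose[OF represents_bounded_clinear[OF T] E_bounded_clinear[OF M]])
  fix x
  have "cinner (T (E M x)) x = cinner (E M (T (E M x))) x"
    using represents_commute[OF f T M, of "E M x"] by (simp add: E_idem M)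
  also have "\<dots> = cinner (T (E M x)) (E M x)"
    by (rule adjoint_pairD[OF E_selfadjoint[OF M]])
  also have "\<dots> = (\<integral>z. f z * indicator M z \<partial>\<mu> x)"
    by (simp add: represents_cinner[OF T] integral_mu_projection[OF f M])
  finally show "cinner (T (E M x)) x = (\<integral>z. f z * indicator M z \<partial>\<mu> x)" by simp
qed

text \<open>
  The properties that are carried along while operators are constructed for more and more functions.
  Multiplicativity is needed inside the construction, since it gives the norm of
  \<open>(\<integral> f dE) x\<close> and thereby convergence; commutation with the commutant of \<open>E\<close> passes to strong limits
  as well.
\<close>

definition represents_mult :: "(complex \<Rightarrow> complex) \<Rightarrow> ('h \<Rightarrow> 'h) \<Rightarrow> bool" where
  "represents_mult g U \<longleftrightarrow> represents g U \<and>
     (\<forall>f T. bounded_borel f \<longrightarrow> represents f T \<longrightarrow> represents (\<lambda>z. f z * g z) (\<lambda>x. T (U x))) \<and>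
     (\<forall>V. bounded_clinear V \<longrightarrow> (\<forall>M\<in>sets borel. \<forall>x. V (E M x) = E M (V x)) \<longrightarrow>
        (\<forall>x. V (U x) = U (V x)))"

lemma represents_multD:
  assumes "represents_mult g U"
  shows "represents g U"
    and "bounded_borel f \<Longrightarrow> represents f T \<Longrightarrow> represents (\<lambda>z. f z * g z) (\<lambda>x. T (U x))"
    and "bounded_clinear V \<Longrightarrow> (\<And>M x. M \<in> sets borel \<Longrightarrow> V (E M x) = E M (V x)) \<Longrightarrow> V (U x) = U (V x)"
  using assms by (auto simp: represents_mult_def)

lemma represents_mult_add:
  assumes "bounded_borel f" "bounded_borel g" "represents_mult f T" "represents_mult g S"
  shows "represents_mult (\<lambda>z. f z + g z) (\<lambda>x. T x + S x)"
  unfolding represents_mult_def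
proof (intro conjI allI impI)
  show "represents (\<lambda>z. f z + g z) (\<lambda>x. T x + S x)"
    using assms by (simp add: represents_mult_def represents_add)
next
  fix h R assume h: "bounded_borel h" and R: "represents h R"
  have "represents (\<lambda>z. h z * f z + h z * g z) (\<lambda>x. R (T x) + R (S x))"
    using assms h R by (intro represents_add bounded_borel_mult represents_multD(2))
  then show "represents (\<lambda>z. h z * (f z + g z)) (\<lambda>x. R (T x + S x))"
    by (simp add: distrib_left bounded_clinear_add[OF represents_bounded_clinear[OF R]])
next
  fix V x assume "bounded_clinear V" "\<forall>M\<in>sets borel. \<forall>x. V (E M x) = E M (V x)"
  then show "V (T x + S x) = T (V x) + S (V x)"
    using assms(3,4) by (simp add: represents_mult_def bounded_clinear_add)
qed

lemma represents_mult_scale: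
  assumes "represents_mult f T"
  shows "represents_mult (\<lambda>z. c * f z) (\<lambda>x. c *\<^sub>C T x)"
  unfolding represents_mult_def
proof (intro conjI allI impI)
  show "represents (\<lambda>z. c * f z) (\<lambda>x. c *\<^sub>C T x)"
    using assms by (simp add: represents_mult_def represents_scale)
next
  fix h R assume h: "bounded_borel h" and R: "represents h R"
  have "represents (\<lambda>z. c * (h z * f z)) (\<lambda>x. c *\<^sub>C R (T x))"
    using assms h R by (intro represents_scale represents_multD(2))
  then show "represents (\<lambda>z. h z * (c * f z)) (\<lambda>x. R (c *\<^sub>C T x))"
    by (simp add: mult.left_commute bounded_clinear_scaleC[OF represents_bounded_clinear[OF R]])
next
  fix V x assume "bounded_clinear V" "\<forall>M\<in>sets borel. \<forall>x. V (E M x) = E M (V x)"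
  then show "V (c *\<^sub>C T x) = c *\<^sub>C T (V x)"
    using assms by (simp add: represents_mult_def bounded_clinear_scaleC)
qed

lemma represents_mult_indicator:
  "M \<in> sets borel \<Longrightarrow> represents_mult (indicator M) (E M)"
  unfolding represents_mult_def
  using represents_indicator represents_times_indicator by blast

lemma represents_cnj_adjoint:
  assumes "bounded_borel f" "represents f T" "represents (\<lambda>z. cnj (f z)) S"
  shows "adjoint_pair T S"
proof (rule adjoint_pairI_diagonal)
  fix x
  have "cinner x (S x) = cnj (cinner (S x) x)" by (rule cinner_commute)
  also have "\<dots> = (\<integral>z. f z \<partial>\<mu> x)"
    using assms by (simp add: represents_cinner)
  finally show "cinner (T x) x = cinner x (S x)" using assms by (simp add: represents_cinner)
qed (use assms in \<open>auto simp: represents_def\<close>)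

lemma represents_real_norm_square:
  fixes g :: "complex \<Rightarrow> real"
  assumes g: "bounded_borel (\<lambda>z. of_real (g z))" and U: "represents_mult (\<lambda>z. of_real (g z)) U"
  shows "(norm (U x))\<^sup>2 = (\<integral>z. (g z)\<^sup>2 \<partial>\<mu> x)"
proof -
  have r: "represents (\<lambda>z. of_real (g z)) U" using U by (simp add: represents_mult_def)
  have adj: "adjoint_pair U U" using represents_cnj_adjoint[OF g r] r by simp
  have "represents (\<lambda>z. of_real (g z) * of_real (g z)) (\<lambda>x. U (U x))"
    by (rule represents_multD(2)[OF U g r])
  then have "cinner (U (U x)) x = of_real (\<integral>z. (g z)\<^sup>2 \<partial>\<mu> x)"
    by (simp add: represents_def power2_eq_square flip: of_real_mult integral_complex_of_real)
  moreover have "cinner (U (U x)) x = of_real ((norm (U x))\<^sup>2)"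
    using adjoint_pairD[OF adj, of "U x" x] by (simp add: cinner_self)
  ultimately show ?thesis using of_real_eq_iff by metis
qed

text \<open>
  Induction along the generation of measurable functions from indicators. At an increasing limit
  \<open>G i \<up> g\<close> the operators \<open>U i\<close> of \<open>G i\<close> satisfy
  \<open>\<parallel>(U i - U j) x\<parallel>\<^sup>2 = \<integral> (G i - G j)\<^sup>2 d\<mu> x \<le> \<integral> (g - G j)\<^sup>2 d\<mu> x\<close> for \<open>j \<le> i\<close>, and the last
  integral tends to zero by dominated convergence. So they converge strongly, and all properties are
  inherited by the limit.
\<close>

lemma represents_mult_exists_nonneg:
  fixes g :: "complex \<Rightarrow> real"
  assumes "g \<in> borel_measurable borel" "\<And>z. 0 \<le> g z" "\<And>z. g z \<le> C"
  shows "\<exists>U. represents_mult (\<lambda>z. of_real (g z)) U"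
proof -
  have "(\<exists>C. \<forall>z. g z \<le> C) \<longrightarrow> (\<exists>U. represents_mult (\<lambda>z. of_real (g z)) U)"
    using assms(1,2)
  proof (induction rule: borel_measurable_induct_real)
    case (set A)
    have "(\<lambda>z. complex_of_real (indicator A z)) = indicator A"
      by (auto split: split_indicator)
    then show ?case using represents_mult_indicator[OF set] by auto
  next
    case (mult u c)
    show ?case
    proof (cases "c = 0")
      case True
      \<comment> \<open>Here \<open>u\<close> itself may be unbounded, so the induction hypothesis says nothing.\<close>
      then show ?thesis using represents_mult_scale[OF represents_mult_indicator[of "{}"], of 0] by auto
    next
      case False
      show ?thesis
      proof
        assume "\<exists>C. \<forall>z. c * u z \<le> C"
        then obtain C where "\<And>z. c * u z \<le> C" by blast
        then have "\<forall>z. u z \<le> C / c" using False mult by (simp add: field_simps)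
        then obtain U where "represents_mult (\<lambda>z. of_real (u z)) U" using mult by blast
        from represents_mult_scale[OF this, of "of_real c"]
        show "\<exists>U. represents_mult (\<lambda>z. of_real (c * u z)) U" by auto
      qed
    qed
  next
    case (add u v)
    show ?case
    proof
      assume "\<exists>C. \<forall>z. v z + u z \<le> C"
      then obtain C where C: "\<And>z. v z + u z \<le> C" by blast
      have le: "u z \<le> C" "v z \<le> C" for z
        using C[of z] add(2)[of z] add(4)[of z] by linarith+
      then obtain U V where "represents_mult (\<lambda>z. of_real (u z)) U" "represents_mult (\<lambda>z. of_real (v z)) V"
        using add by blast
      moreover have "bounded_borel (\<lambda>z. of_real (u z))" "bounded_borel (\<lambda>z. of_real (v z))"
        using add le by (auto intro!: bounded_borelI[where C=C])
      ultimately show "\<exists>U. represents_mult (\<lambda>z. of_real (v z + u z)) U"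
        using represents_mult_add by fastforce
    qed
  next
    case (seq G)
    show ?case
    proof
      assume "\<exists>C. \<forall>z. g z \<le> C"
      then obtain C where C: "\<And>z. g z \<le> C" by blast
      have lim: "(\<lambda>i. G i z) \<longlonglongrightarrow> g z" for z using seq(4) by simp
      have mono: "G i z \<le> G j z" if "i \<le> j" for i j z
        using seq(3) that by (simp add: incseq_def le_fun_def)
      have Gg: "G i z \<le> g z" for i z
        by (rule incseq_le[OF _ lim]) (simp add: incseq_def mono)
      have GC: "G i z \<le> C" for i z using Gg C order_trans by blast
      have C0: "0 \<le> C" using C assms(2) order_trans by blast
      have bb: "bounded_borel (\<lambda>z. of_real (G i z))" for i
        using seq(1)[of i] seq(2)[of i] GC by (auto intro!: bounded_borelI[where C=C])
      have bbg: "bounded_borel (\<lambda>z. of_real (g z))"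
        using assms C by (auto intro!: bounded_borelI[where C=C])
      have "\<forall>i. \<exists>U. represents_mult (\<lambda>z. of_real (G i z)) U"
        using seq(5) GC by blast
      then obtain U where U: "\<And>i. represents_mult (\<lambda>z. of_real (G i z)) (U i)" by metis
      note lin = U[unfolded represents_mult_def, THEN conjunct1, THEN represents_bounded_clinear]
      define a where "a j x = (\<integral>z. (g z - G j z)\<^sup>2 \<partial>\<mu> x)" for j x
      have a0: "(\<lambda>j. a j x) \<longlonglongrightarrow> 0" for x
      proof -
        have "(\<lambda>j. a j x) \<longlonglongrightarrow> (\<integral>z. 0 \<partial>\<mu> x)"
          unfolding a_def
        proof (rule integral_dominated_convergence[where w="\<lambda>z. C\<^sup>2"])
          show "integrable (\<mu> x) (\<lambda>z. C\<^sup>2)"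
            by (simp add: finite_measure.integrable_const[OF finite_measure_mu])
          have "(\<lambda>j. (g z - G j z)\<^sup>2) \<longlonglongrightarrow> (g z - g z)\<^sup>2" for z
            by (intro tendsto_intros lim)
          then show "AE z in \<mu> x. (\<lambda>j. (g z - G j z)\<^sup>2) \<longlonglongrightarrow> 0" by simp
          have "(g z - G j z)\<^sup>2 \<le> C\<^sup>2" for z j
            using Gg[of j z] C[of z] seq(2)[of j z] by (intro power_mono) auto
          then show "AE z in \<mu> x. norm ((g z - G j z)\<^sup>2) \<le> C\<^sup>2" for j by simp
        qed (use assms seq(1) in auto)
        then show ?thesis by simp
      qed
      have dist: "(norm (U i x - U j x))\<^sup>2 \<le> a j x" if "j \<le> i" for i j x
      proof -
        have "represents_mult (\<lambda>z. of_real (G i z) + (-1) * of_real (G j z)) (\<lambda>x. U i x + (-1) *\<^sub>C U j x)"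
          by (intro represents_mult_add represents_mult_scale U bb bounded_borel_mult bounded_borel_const)
        then have r: "represents_mult (\<lambda>z. of_real (G i z - G j z)) (\<lambda>x. U i x - U j x)"
          by (simp add: scaleC_minus_one)
        have b: "bounded_borel (\<lambda>z. of_real (G i z - G j z))"
          using bounded_borel_add[OF bb[of i] bounded_borel_mult[OF bounded_borel_const[of "-1"] bb[of j]]]
          by simp
        have "(norm (U i x - U j x))\<^sup>2 = (\<integral>z. (G i z - G j z)\<^sup>2 \<partial>\<mu> x)"
          by (rule represents_real_norm_square[OF b r])
        also have "\<dots> \<le> a j x"
          unfolding a_def
        proof (rule integral_mono)
          have i1: "norm ((G i z - G j z)\<^sup>2) \<le> C\<^sup>2" for z
            using mono[OF that, of z] GC[of i z] seq(2)[of j z] by (auto intro: power_mono)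
          have i2: "norm ((g z - G j z)\<^sup>2) \<le> C\<^sup>2" for z
            using Gg[of j z] C[of z] seq(2)[of j z] by (auto intro: power_mono)
          show "integrable (\<mu> x) (\<lambda>z. (G i z - G j z)\<^sup>2)" "integrable (\<mu> x) (\<lambda>z. (g z - G j z)\<^sup>2)"
            using assms(1) seq(1) i1 i2
            by (auto intro!: finite_measure.integrable_const_bound[OF finite_measure_mu, where B="C\<^sup>2"])
          show "(G i z - G j z)\<^sup>2 \<le> (g z - G j z)\<^sup>2" for z
            using mono[OF that, of z] Gg[of i z] by (intro power_mono) auto
        qed
        finally show ?thesis .
      qed
      have "convergent (\<lambda>i. U i x)" for x
      proof (rule Cauchy_convergent, rule CauchyI')
        fix e :: real assume "0 < e"
        then have "\<forall>\<^sub>F j in sequentially. a j x < (e/2)\<^sup>2"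
          by (intro order_tendstoD(2)[OF a0]) simp
        then obtain N where N: "a N x < (e/2)\<^sup>2" by (meson eventually_sequentially order_refl)
        have near: "norm (U i x - U N x) < e/2" if "N \<le> i" for i
          using dist[OF that, of x] N \<open>0 < e\<close>
          by (intro power2_less_imp_less[of _ "e/2"]) auto
        have "norm (U m x - U n x) < e" if "N \<le> m" "m < n" for m n
        proof -
          have "norm (U m x - U n x) \<le> norm (U m x - U N x) + norm (U n x - U N x)"
            using norm_triangle_ineq4[of "U m x - U N x" "U n x - U N x"] by simp
          then show ?thesis using near[of m] near[of n] that by simp
        qed
        then show "\<exists>M. \<forall>m\<ge>M. \<forall>n>m. dist (U m x) (U n x) < e" unfolding dist_norm by blast
      qed
      then obtain W where W: "\<And>x. (\<lambda>i. U i x) \<longlonglongrightarrow> W x"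
        unfolding convergent_def by metis
      have linW: "bounded_clinear W"
      proof (rule bounded_clinearI[where K=C])
        fix x y
        have "(\<lambda>i. U i (x + y)) \<longlonglongrightarrow> W x + W y"
          unfolding bounded_clinear_add[OF lin] by (intro tendsto_add W)
        then show "W (x + y) = W x + W y" using W LIMSEQ_unique by blast
      next
        fix c x
        \<comment> \<open>Multiplication by \<open>c\<close> is continuous, being a multiple of the identity \<open>E UNIV\<close>.\<close>
        have "(\<lambda>i. c *\<^sub>C U i x) \<longlonglongrightarrow> c *\<^sub>C W x"
          using bounded_clinear_tendsto[OF bounded_clinear_scale[OF orthogonal_projection_bounded_clinear[OF projection[of UNIV]]] W]
          by (simp add: E_UNIV)
        then have "(\<lambda>i. U i (c *\<^sub>C x)) \<longlonglongrightarrow> c *\<^sub>C W x"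
          by (simp add: bounded_clinear_scaleC[OF lin])
        then show "W (c *\<^sub>C x) = c *\<^sub>C W x" using W LIMSEQ_unique by blast
      next
        fix x
        have "norm (U i x) \<le> norm x * C" for i
        proof -
          have "(norm (U i x))\<^sup>2 = (\<integral>z. (G i z)\<^sup>2 \<partial>\<mu> x)"
            by (rule represents_real_norm_square[OF bb U])
          also have "\<dots> \<le> (\<integral>z. C\<^sup>2 \<partial>\<mu> x)"
          proof (rule integral_mono)
            have i1: "norm ((G i z)\<^sup>2) \<le> C\<^sup>2" for z
              using GC[of i z] seq(2)[of i z] by (auto intro: power_mono)
            then show "integrable (\<mu> x) (\<lambda>z. (G i z)\<^sup>2)"
              using assms(1) seq(1)
              by (auto intro!: finite_measure.integrable_const_bound[OF finite_measure_mu, where B="C\<^sup>2"])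
            show "(G i z)\<^sup>2 \<le> C\<^sup>2" for z using i1[of z] by simp
          qed (simp add: finite_measure.integrable_const[OF finite_measure_mu])
          also have "\<dots> = (norm x * C)\<^sup>2"
            by (simp add: measure_mu E_UNIV power_mult_distrib)
          finally show ?thesis by (rule power2_le_imp_le) (simp add: C0)
        qed
        then show "norm (W x) \<le> norm x * C"
          using Lim_bounded[OF tendsto_norm[OF W]] by blast
      qed
      have conv: "(\<lambda>i. \<integral>z. f z * of_real (G i z) \<partial>\<mu> x) \<longlonglongrightarrow> (\<integral>z. f z * of_real (g z) \<partial>\<mu> x)"
        if f: "bounded_borel f" for f x
      proof (rule integral_dominated_convergence[where w="\<lambda>z. cmod (f z) * C"])
        show "integrable (\<mu> x) (\<lambda>z. cmod (f z) * C)"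
          using integrable_norm[OF bounded_borel_integrable[OF f]] by simp
        show "AE z in \<mu> x. (\<lambda>i. f z * complex_of_real (G i z)) \<longlonglongrightarrow> f z * complex_of_real (g z)"
          by (intro AE_I2 tendsto_intros lim)
        show "AE z in \<mu> x. norm (f z * complex_of_real (G i z)) \<le> cmod (f z) * C" for i
          using GC[of i] seq(2)[of i] by (intro AE_I2) (auto simp: norm_mult intro!: mult_left_mono)
      qed (use assms(1) seq(1) bounded_borel_measurable[OF f] in auto)
      have "represents_mult (\<lambda>z. of_real (g z)) W"
        unfolding represents_mult_def
      proof (intro conjI allI impI)
        show "represents (\<lambda>z. of_real (g z)) W"
          unfolding represents_def
        proof (intro conjI allI linW)
          fix x
          have "(\<lambda>i. cinner (U i x) x) \<longlonglongrightarrow> cinner (W x) x"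
            by (intro cinner.tendsto W tendsto_const)
          moreover have "(\<lambda>i. cinner (U i x) x) \<longlonglongrightarrow> (\<integral>z. of_real (g z) \<partial>\<mu> x)"
            using conv[OF bounded_borel_const[of 1], of x]
            represents_cinner[OF represents_multD(1)[OF U], of _ x] by simp
          ultimately show "cinner (W x) x = (\<integral>z. of_real (g z) \<partial>\<mu> x)" by (rule LIMSEQ_unique)
        qed
      next
        fix f T assume f: "bounded_borel f" and T: "represents f T"
        show "represents (\<lambda>z. f z * of_real (g z)) (\<lambda>x. T (W x))"
          unfolding represents_def
        proof (intro conjI allI)
          show "bounded_clinear (\<lambda>x. T (W x))"
            by (rule bounded_clinear_compose[OF represents_bounded_clinear[OF T] linW])
          fix x
          have "(\<lambda>i. cinner (T (U i x)) x) \<longlonglongrightarrow> cinner (T (W x)) x"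
            using bounded_clinear_tendsto[OF represents_bounded_clinear[OF T] W]
            by (intro cinner.tendsto tendsto_const) simp
          moreover have "cinner (T (U i x)) x = (\<integral>z. f z * of_real (G i z) \<partial>\<mu> x)" for i
            using represents_cinner[OF represents_multD(2)[OF U f T]] .
          ultimately show "cinner (T (W x)) x = (\<integral>z. f z * of_real (g z) \<partial>\<mu> x)"
            using conv[OF f, of x] LIMSEQ_unique by simp
        qed
      next
        fix V x assume V: "bounded_clinear V" and "\<forall>M\<in>sets borel. \<forall>x. V (E M x) = E M (V x)"
        then have "V (U i x) = U i (V x)" for i
          using U[of i] by (simp add: represents_mult_def)
        then have "(\<lambda>i. U i (V x)) \<longlonglongrightarrow> V (W x)"
          using bounded_clinear_tendsto[OF V W[of x]] by simp
        then show "V (W x) = W (V x)" using W LIMSEQ_unique by blast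
      qed
      then show "\<exists>U. represents_mult (\<lambda>z. of_real (g z)) U" by blast
    qed
  qed
  then show ?thesis using assms(3) by blast
qed

text \<open>
  Positive and negative parts of the real and imaginary part reduce the complex case to the
  nonnegative one.
\<close>

lemma represents_mult_exists:
  assumes f: "bounded_borel f"
  shows "\<exists>T. represents_mult f T"
proof -
  obtain C where C: "\<And>z. cmod (f z) \<le> C" using f unfolding bounded_borel_def by blast
  have meas: "f \<in> borel_measurable borel" using f by (rule bounded_borel_measurable)
  have ex: "bounded_borel (\<lambda>z. of_real (max 0 (s z))) \<and> (\<exists>T. represents_mult (\<lambda>z. of_real (max 0 (s z))) T)"
    if "s \<in> borel_measurable borel" "\<And>z. \<bar>s z\<bar> \<le> cmod (f z)" for s
  proof -
    have le: "max 0 (s z) \<le> C" for z using that(2)[of z] C[of z] norm_ge_zero[of "f z"] by linarith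
    have "bounded_borel (\<lambda>z. of_real (max 0 (s z)))"
      using that(1) le by (intro bounded_borelI[where C=C]) auto
    moreover have "\<exists>T. represents_mult (\<lambda>z. of_real (max 0 (s z))) T"
      using that(1) le by (intro represents_mult_exists_nonneg[where C=C]) auto
    ultimately show ?thesis ..
  qed
  let ?p = "\<lambda>z. Re (f z)" and ?q = "\<lambda>z. - Re (f z)" and ?r = "\<lambda>z. Im (f z)" and ?s = "\<lambda>z. - Im (f z)"
  have "?p \<in> borel_measurable borel" "?q \<in> borel_measurable borel"
    "?r \<in> borel_measurable borel" "?s \<in> borel_measurable borel"
    using meas by auto
  then obtain P Q R S where
    PQRS: "bounded_borel (\<lambda>z. of_real (max 0 (?p z)))" "represents_mult (\<lambda>z. of_real (max 0 (?p z))) P"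
    "bounded_borel (\<lambda>z. of_real (max 0 (?q z)))" "represents_mult (\<lambda>z. of_real (max 0 (?q z))) Q"
    "bounded_borel (\<lambda>z. of_real (max 0 (?r z)))" "represents_mult (\<lambda>z. of_real (max 0 (?r z))) R"
    "bounded_borel (\<lambda>z. of_real (max 0 (?s z)))" "represents_mult (\<lambda>z. of_real (max 0 (?s z))) S"
    using ex[of ?p] ex[of ?q] ex[of ?r] ex[of ?s] abs_Re_le_cmod abs_Im_le_cmod by auto
  let ?g = "\<lambda>z. (of_real (max 0 (?p z)) + (-1) * of_real (max 0 (?q z))) +
    (\<i> * of_real (max 0 (?r z)) + (-\<i>) * of_real (max 0 (?s z)))"
  have "represents_mult ?g (\<lambda>x. (P x + (-1) *\<^sub>C Q x) + (\<i> *\<^sub>C R x + (-\<i>) *\<^sub>C S x))"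
    by (intro represents_mult_add represents_mult_scale PQRS
        bounded_borel_add bounded_borel_mult[OF bounded_borel_const])
  moreover have "?g = f"
    by (auto simp: fun_eq_iff complex_eq_iff max_def)
  ultimately show ?thesis by metis
qed

definition \<Phi> :: "(complex \<Rightarrow> complex) \<Rightarrow> 'h \<Rightarrow> 'h" where
  "\<Phi> f = (THE T. represents f T)"

lemma represents_mult_Phi:
  assumes "bounded_borel f"
  shows "represents_mult f (\<Phi> f)"
proof -
  obtain T where T: "represents_mult f T" using represents_mult_exists[OF assms] by blast
  then have "\<Phi> f = T"
    unfolding \<Phi>_def by (intro the_equality) (auto simp: represents_mult_def intro: represents_unique)
  with T show ?thesis by simp
qed

lemma represents_Phi: "bounded_borel f \<Longrightarrow> represents f (\<Phi> f)"
  using represents_mult_Phi by (simp add: represents_mult_def)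

lemmas Phi_bounded_clinear = represents_Phi[THEN represents_bounded_clinear]
lemmas Phi_cinner = represents_Phi[THEN represents_cinner]

lemma Phi_mult:
  assumes "bounded_borel f" "bounded_borel g"
  shows "\<Phi> f (\<Phi> g x) = \<Phi> (\<lambda>z. f z * g z) x"
proof -
  have "represents (\<lambda>z. f z * g z) (\<lambda>x. \<Phi> f (\<Phi> g x))"
    using represents_mult_Phi[OF assms(2)] represents_Phi[OF assms(1)] assms(1)
    by (simp add: represents_mult_def)
  from represents_unique[OF this represents_Phi[OF bounded_borel_mult[OF assms]]]
  show ?thesis by metis
qed

lemma Phi_indicator: "M \<in> sets borel \<Longrightarrow> \<Phi> (indicator M) = E M"
  by (intro represents_unique[OF represents_Phi represents_indicator] bounded_borel_indicator)

lemma Phi_adjoint: "bounded_borel f \<Longrightarrow> adjoint_pair (\<Phi> f) (\<Phi> (\<lambda>z. cnj (f z)))"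
  by (rule represents_cnj_adjoint[OF _ represents_Phi represents_Phi[OF bounded_borel_cnj]])

lemma Phi_commute:
  "bounded_borel f \<Longrightarrow> bounded_clinear V \<Longrightarrow> (\<And>M x. M \<in> sets borel \<Longrightarrow> V (E M x) = E M (V x)) \<Longrightarrow>
    V (\<Phi> f x) = \<Phi> f (V x)"
  using represents_mult_Phi[of f] by (simp add: represents_mult_def)

lemma Phi_norm_square:
  assumes f: "bounded_borel f"
  shows "(norm (\<Phi> f x))\<^sup>2 = (\<integral>z. (cmod (f z))\<^sup>2 \<partial>\<mu> x)"
proof -
  have "of_real ((norm (\<Phi> f x))\<^sup>2) = cinner x (\<Phi> (\<lambda>z. cnj (f z)) (\<Phi> f x))"
    using adjoint_pairD[OF Phi_adjoint[OF f], of x "\<Phi> f x"] by (simp add: cinner_self)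
  also have "\<dots> = cnj (cinner (\<Phi> (\<lambda>z. cnj (f z) * f z) x) x)"
    by (subst cinner_commute) (simp add: Phi_mult bounded_borel_cnj f)
  also have "\<dots> = cnj (\<integral>z. of_real ((cmod (f z))\<^sup>2) \<partial>\<mu> x)"
    unfolding Phi_cinner[OF bounded_borel_mult[OF bounded_borel_cnj[OF f] f]]
    by (simp only: complex_norm_square mult.commute)
  also have "\<dots> = of_real (\<integral>z. (cmod (f z))\<^sup>2 \<partial>\<mu> x)"
    by (simp del: of_real_power)
  finally show ?thesis by (simp only: of_real_eq_iff)
qed

end

section \<open>Unbounded operators as strong limits\<close>

lemma graph_iff: "(x, y) \<in> Map.graph T \<longleftrightarrow> T x = Some y"
  by (auto simp: Map.graph_def)

lemma partial_map_eqI: "(\<And>x y. S x = Some y \<longleftrightarrow> T x = Some y) \<Longrightarrow> S = T"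
  by (metis not_Some_eq ext)

lemma graph_inject: "Map.graph S = Map.graph T \<Longrightarrow> S = T"
  by (rule partial_map_eqI) (simp flip: graph_iff)

lemma closure_graph_imp:
  assumes "closure (Map.graph T) = Map.graph R"
  shows "closable T" "operator_closure T = R"
  using assms graph_inject by (auto simp: closable_def operator_closure_def intro!: the_equality)

lemma adjoint_operator_eq_Some_iff:
  assumes "densely_defined T"
  shows "adjoint_operator T y = Some z \<longleftrightarrow> (\<forall>x u. T x = Some u \<longrightarrow> cinner u y = cinner x z)"
    (is "_ \<longleftrightarrow> ?P z")
proof -
  have unique: "z = z'" if "?P z" "?P z'" for z z'
  proof -
    have "cinner (z - z') x = 0" if "x \<in> dom T" for x
    proof -
      have "cinner x (z - z') = 0"
        using that \<open>?P z\<close> \<open>?P z'\<close> by (auto simp: cinner.diff_right)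
      then show ?thesis by (subst cinner_commute) simp
    qed
    then have "z - z' = 0"
      by (rule orthogonal_dense_imp_zero[OF assms[unfolded densely_defined_def]])
    then show ?thesis by simp
  qed
  show ?thesis
  proof
    assume "adjoint_operator T y = Some z"
    then have ex: "\<exists>z. ?P z" and z: "z = (THE z. ?P z)"
      by (auto simp: adjoint_operator_def split: if_splits)
    have "\<exists>!z. ?P z" using ex unique by blast
    then show "?P z" unfolding z by (rule theI')
  next
    assume z: "?P z"
    then have ex: "\<exists>z. ?P z" by blast
    have the: "(THE z. ?P z) = z"
    proof (rule the_equality[where P="?P"])
      show "z' = z" if "?P z'" for z' using that z by (rule unique)
    qed (rule z)
    show "adjoint_operator T y = Some z"
      unfolding adjoint_operator_def if_P[OF ex] the by (rule refl)
  qed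
qed

text \<open>
  The operator \<open>x \<mapsto> lim T n x\<close>, defined wherever the limit exists. Every unbounded operator in the
  proof is of this form.
\<close>

definition strong_limit :: "(nat \<Rightarrow> 'h::complex_hilbert_space \<Rightarrow> 'h) \<Rightarrow> ('h \<rightharpoonup> 'h)" where
  "strong_limit T x = (if convergent (\<lambda>n. T n x) then Some (lim (\<lambda>n. T n x)) else None)"

lemma strong_limit_eq_Some_iff_tendsto:
  "strong_limit T x = Some y \<longleftrightarrow> (\<lambda>n. T n x) \<longlonglongrightarrow> y"
  using convergent_LIMSEQ_iff[of "\<lambda>n. T n x"] convergentI[of "\<lambda>n. T n x" y] limI[of "\<lambda>n. T n x" y]
  by (auto simp: strong_limit_def)

text \<open>
  The product law says that the projections increase with \<open>n\<close>: their ranges are the reducing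
  subspaces that exhaust the space.
\<close>

locale exhaustion =
  fixes Q :: "nat \<Rightarrow> 'h::complex_hilbert_space \<Rightarrow> 'h"
  assumes Q_projection: "orthogonal_projection (Q n)"
    and Q_Q: "Q m (Q n x) = Q (min m n) x"
    and Q_tendsto: "(\<lambda>n. Q n x) \<longlonglongrightarrow> x"
begin

lemmas Q_lin = Q_projection[THEN orthogonal_projection_bounded_clinear]
lemmas Q_adj = Q_projection[THEN orthogonal_projection_selfadjoint]

text \<open>
  \<open>T n\<close> lives on the range of \<open>Q n\<close>, is reduced by every smaller \<open>Q m\<close>, and restricts there to
  \<open>T m\<close>. Thus a coherent family is one unbounded operator cut down to an exhausting sequence of
  reducing subspaces on which it is bounded.
\<close>

definition coherent :: "(nat \<Rightarrow> 'h \<Rightarrow> 'h) \<Rightarrow> bool" where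
  "coherent T \<longleftrightarrow> (\<forall>n. bounded_clinear (T n)) \<and>
     (\<forall>m n x. T m (Q n x) = T (min m n) x) \<and> (\<forall>m n x. Q n (T m x) = T (min m n) x)"

lemma coherentD:
  assumes "coherent T"
  shows "bounded_clinear (T n)" "T m (Q n x) = T (min m n) x" "Q n (T m x) = T (min m n) x"
  using assms by (simp_all add: coherent_def)

lemma coherent_compose:
  assumes "coherent S" "coherent T"
  shows "coherent (\<lambda>n x. S n (T n x))"
  unfolding coherent_def
proof (intro conjI allI)
  have *: "S i (T j x) = S (min i j) (T (min i j) x)" for i j x
  proof -
    have "S i (T j x) = S i (Q j (T j x))" by (simp add: coherentD(3)[OF assms(2)])
    also have "\<dots> = S (min i j) (T j x)" by (rule coherentD(2)[OF assms(1)])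
    also have "\<dots> = S (min i j) (Q (min i j) (T j x))" by (simp add: coherentD(2)[OF assms(1)])
    also have "\<dots> = S (min i j) (T (min i j) x)" by (simp add: coherentD(3)[OF assms(2)] min.commute)
    finally show ?thesis .
  qed
  show "bounded_clinear (\<lambda>x. S n (T n x))" for n
    by (rule bounded_clinear_compose[OF coherentD(1)[OF assms(1)] coherentD(1)[OF assms(2)]])
  show "S m (T m (Q n x)) = S (min m n) (T (min m n) x)" for m n x
    using *[of m "min m n" x] by (simp add: coherentD(2)[OF assms(2)])
  show "Q n (S m (T m x)) = S (min m n) (T (min m n) x)" for m n x
    using *[of "min m n" m x] by (simp add: coherentD(3)[OF assms(1)] min.commute min.left_commute)
qed

text \<open>
  This characterisation describes the graph of the strong limit by continuous linear equations, and
  replaces limits in most of what follows. For the forward direction, \<open>Q n (T m x) = T n x\<close>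
  as soon as \<open>m \<ge> n\<close>.
\<close>

lemma strong_limit_eq_Some_iff:
  assumes T: "coherent T"
  shows "strong_limit T x = Some y \<longleftrightarrow> (\<forall>n. T n x = Q n y)"
proof
  assume "strong_limit T x = Some y"
  then have lim: "(\<lambda>m. T m x) \<longlonglongrightarrow> y" by (simp add: strong_limit_eq_Some_iff_tendsto)
  show "\<forall>n. T n x = Q n y"
  proof
    fix n
    have "(\<lambda>m. Q n (T m x)) \<longlonglongrightarrow> Q n y"
      by (rule bounded_clinear_tendsto[OF Q_lin lim])
    moreover have "(\<lambda>m. Q n (T m x)) \<longlonglongrightarrow> T n x"
      by (rule tendsto_eventually, rule eventually_sequentiallyI[of n])
        (simp add: coherentD(3)[OF T] min_absorb2)
    ultimately show "T n x = Q n y" using LIMSEQ_unique by blast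
  qed
next
  assume "\<forall>n. T n x = Q n y"
  then show "strong_limit T x = Some y"
    using Q_tendsto by (simp add: strong_limit_eq_Some_iff_tendsto)
qed

lemma strong_limit_on_range:
  assumes T: "coherent T"
  shows "strong_limit T (Q n x) = Some (T n x)"
  using coherentD(2,3)[OF T] by (simp add: strong_limit_eq_Some_iff[OF T] min.commute)

lemma strong_limit_linear:
  assumes T: "coherent T"
  shows "linear_operator (strong_limit T)"
  unfolding linear_operator_def strong_limit_eq_Some_iff[OF T]
  by (simp add: bounded_clinear_zero[OF coherentD(1)[OF T]] bounded_clinear_zero[OF Q_lin]
      bounded_clinear_add[OF coherentD(1)[OF T]] bounded_clinear_add[OF Q_lin]
      bounded_clinear_scaleC[OF coherentD(1)[OF T]] bounded_clinear_scaleC[OF Q_lin])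

lemma strong_limit_densely_defined:
  assumes T: "coherent T"
  shows "densely_defined (strong_limit T)"
proof -
  have "x \<in> closure (dom (strong_limit T))" for x
    unfolding closure_sequential
    by (rule exI[of _ "\<lambda>n. Q n x"]) (auto simp: strong_limit_on_range[OF T] Q_tendsto)
  then show ?thesis by (auto simp: densely_defined_def)
qed

lemma strong_limit_graph_closed:
  assumes T: "coherent T"
  shows "closed (Map.graph (strong_limit T))"
  unfolding closed_sequential_limits
proof (intro allI impI, elim conjE)
  fix p :: "nat \<Rightarrow> 'h \<times> 'h" and l
  assume p: "\<forall>j. p j \<in> Map.graph (strong_limit T)" and lim: "p \<longlonglongrightarrow> l"
  have "T n (fst l) = Q n (snd l)" for n
  proof -
    have "(\<lambda>j. T n (fst (p j))) \<longlonglongrightarrow> T n (fst l)"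
      by (rule bounded_clinear_tendsto[OF coherentD(1)[OF T] tendsto_fst[OF lim]])
    moreover have "(\<lambda>j. Q n (snd (p j))) \<longlonglongrightarrow> Q n (snd l)"
      by (rule bounded_clinear_tendsto[OF Q_lin tendsto_snd[OF lim]])
    moreover have "T n (fst (p j)) = Q n (snd (p j))" for j
      using p strong_limit_eq_Some_iff[OF T] by (metis graph_iff prod.collapse)
    ultimately show ?thesis using LIMSEQ_unique by simp
  qed
  then have "strong_limit T (fst l) = Some (snd l)"
    by (simp add: strong_limit_eq_Some_iff[OF T])
  then show "l \<in> Map.graph (strong_limit T)"
    using graph_iff by (metis prod.collapse)
qed

text \<open>
  Testing the defining equation of the adjoint on the vectors \<open>Q n w\<close> yields exactly the equations
  \<open>T' n y = Q n z\<close> of the graph of the limit of the adjoints.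
\<close>

lemma strong_limit_adjoint:
  assumes T: "coherent T" and T': "coherent T'" and adj: "\<And>n. adjoint_pair (T n) (T' n)"
  shows "adjoint_operator (strong_limit T) = strong_limit T'"
proof (rule partial_map_eqI)
  fix y z
  have "(\<forall>x u. strong_limit T x = Some u \<longrightarrow> cinner u y = cinner x z) \<longleftrightarrow> (\<forall>n. T' n y = Q n z)"
  proof (intro iffI allI impI)
    fix n
    assume "\<forall>x u. strong_limit T x = Some u \<longrightarrow> cinner u y = cinner x z"
    then have "cinner (T n w) y = cinner (Q n w) z" for w
      using strong_limit_on_range[OF T] by blast
    then have "cinner w (T' n y) = cinner w (Q n z)" for w
      using adjoint_pairD[OF adj] adjoint_pairD[OF Q_adj] by metis
    then show "T' n y = Q n z" by (rule cinner_ext)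
  next
    fix x u
    assume yz: "\<forall>n. T' n y = Q n z" and "strong_limit T x = Some u"
    then have xu: "T n x = Q n u" for n by (simp add: strong_limit_eq_Some_iff[OF T])
    have "(\<lambda>n. cinner (T n x) y) \<longlonglongrightarrow> cinner u y"
      unfolding xu by (intro cinner.tendsto Q_tendsto tendsto_const)
    moreover have "(\<lambda>n. cinner (T n x) y) \<longlonglongrightarrow> cinner x z"
      using yz by (simp add: adjoint_pairD[OF adj] cinner.tendsto Q_tendsto)
    ultimately show "cinner u y = cinner x z" by (rule LIMSEQ_unique)
  qed
  then show "adjoint_operator (strong_limit T) y = Some z \<longleftrightarrow> strong_limit T' y = Some z"
    by (simp add: adjoint_operator_eq_Some_iff[OF strong_limit_densely_defined[OF T]]
        strong_limit_eq_Some_iff[OF T'])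
qed

text \<open>
  The graph equations of the two factors multiply to those of the product family, whose limit is
  closed. Conversely \<open>(Q n x, Q n z)\<close> lies in the graph of the product and approximates \<open>(x, z)\<close>.
  In particular, the closure of a product of limits depends on the product family alone.
\<close>

lemma strong_limit_product_closure:
  assumes S: "coherent S" and T: "coherent T"
  shows "closure (Map.graph (strong_limit S \<circ>\<^sub>m strong_limit T)) =
    Map.graph (strong_limit (\<lambda>n x. S n (T n x)))" (is "closure ?G = Map.graph ?R")
proof
  note ST = coherent_compose[OF S T]
  have "?G \<subseteq> Map.graph ?R"
  proof
    fix p assume "p \<in> ?G"
    then obtain x y z where p: "p = (x, z)" and "strong_limit T x = Some y" "strong_limit S y = Some z"
      by (cases p) (auto simp: graph_iff map_comp_Some_iff)
    then have "T n x = Q n y" "S n y = Q n z" for n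
      by (simp_all add: strong_limit_eq_Some_iff S T)
    then have "S n (T n x) = Q n z" for n
      by (simp add: coherentD(2)[OF S])
    then show "p \<in> Map.graph ?R"
      by (simp add: p graph_iff strong_limit_eq_Some_iff[OF ST])
  qed
  then show "closure ?G \<subseteq> Map.graph ?R"
    by (rule closure_minimal[OF _ strong_limit_graph_closed[OF ST]])
next
  note ST = coherent_compose[OF S T]
  show "Map.graph ?R \<subseteq> closure ?G"
  proof
    fix p assume "p \<in> Map.graph ?R"
    then obtain x z where p: "p = (x, z)" and "strong_limit (\<lambda>n x. S n (T n x)) x = Some z"
      by (cases p) (auto simp: graph_iff)
    then have xz: "S n (T n x) = Q n z" for n
      by (simp add: strong_limit_eq_Some_iff[OF ST])
    have "strong_limit S (T n x) = Some (Q n z)" for n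
      using strong_limit_on_range[OF S, of n "T n x"] coherentD(3)[OF T, of n n x] xz[of n] by simp
    then have "(Q n x, Q n z) \<in> ?G" for n
      by (auto simp: graph_iff map_comp_Some_iff strong_limit_on_range[OF T])
    moreover have "(\<lambda>n. (Q n x, Q n z)) \<longlonglongrightarrow> (x, z)"
      by (intro tendsto_Pair Q_tendsto)
    ultimately show "p \<in> closure ?G"
      unfolding closure_sequential p by (intro exI[of _ "\<lambda>n. (Q n x, Q n z)"]) blast
  qed
qed

text \<open>
  The natural domain of \<open>T\<^sup>* T\<close> is determined by the family \<open>T' n \<circ> T n\<close>:
  if \<open>S' S = T' T\<close>, then \<open>\<parallel>S n v\<parallel> = \<parallel>T n v\<parallel>\<close> for all \<open>v\<close>, so that \<open>S n x\<close> is a Cauchy sequence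
  whenever \<open>T n x\<close> is. With \<open>S = T\<^sup>*\<close> this gives normality, and with \<open>S\<close> a positive square root it
  identifies the modulus; in both cases including equality of domains.
\<close>

lemma strong_limit_product_subset:
  assumes S: "coherent S" and S': "coherent S'" and T: "coherent T" and T': "coherent T'"
    and adj: "\<And>n. adjoint_pair (S n) (S' n)" "\<And>n. adjoint_pair (T n) (T' n)"
    and eq: "\<And>n x. S' n (S n x) = T' n (T n x)"
    and z: "(strong_limit T' \<circ>\<^sub>m strong_limit T) x = Some z"
  shows "(strong_limit S' \<circ>\<^sub>m strong_limit S) x = Some z"
proof -
  obtain y where "strong_limit T x = Some y" "strong_limit T' y = Some z"
    using z by (auto simp: map_comp_Some_iff)
  then have lim: "(\<lambda>n. T n x) \<longlonglongrightarrow> y" and xy: "\<And>n. T n x = Q n y" and yz: "\<And>n. T' n y = Q n z"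
    using strong_limit_eq_Some_iff_tendsto strong_limit_eq_Some_iff[OF T] strong_limit_eq_Some_iff[OF T']
    by blast+
  have norm_eq: "norm (S n v) = norm (T n v)" for n v
  proof -
    have "cinner (S n v) (S n v) = cinner (T n v) (T n v)"
      by (simp add: adjoint_pairD[OF adj(1)] adjoint_pairD[OF adj(2)] eq)
    then show ?thesis by (simp add: norm_eq_sqrt_cinner)
  qed
  have diff: "R m x - R n x = R m (x - Q n x)" if "coherent R" "n \<le> m" for R m n
    using that by (simp add: bounded_clinear_diff[OF coherentD(1)[OF that(1)]]
        coherentD(2)[OF that(1)] min_absorb2)
  have dist_le: "dist (S m x) (S n x) = dist (T m x) (T n x)" if "n \<le> m" for m n
    unfolding dist_norm diff[OF S that] diff[OF T that] by (rule norm_eq)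
  have dist_eq: "dist (S m x) (S n x) = dist (T m x) (T n x)" for m n
    by (cases "n \<le> m") (use dist_le[of n m] dist_le[of m n] in \<open>auto simp: dist_commute\<close>)
  have "Cauchy (\<lambda>n. S n x)"
    using LIMSEQ_imp_Cauchy[OF lim] by (simp add: Cauchy_def dist_eq)
  then obtain y' where y': "(\<lambda>n. S n x) \<longlonglongrightarrow> y'"
    using Cauchy_convergent convergent_def by blast
  then have Sx: "strong_limit S x = Some y'" by (simp add: strong_limit_eq_Some_iff_tendsto)
  then have xy': "S n x = Q n y'" for n by (simp add: strong_limit_eq_Some_iff[OF S])
  have "S' n y' = Q n z" for n
  proof -
    have "S' n y' = S' n (S n x)" by (simp add: xy' coherentD(2)[OF S'])
    also have "\<dots> = T' n y" by (simp add: eq xy coherentD(2)[OF T'])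
    finally show ?thesis by (simp add: yz)
  qed
  then have "strong_limit S' y' = Some z" by (simp add: strong_limit_eq_Some_iff[OF S'])
  with Sx show ?thesis by (simp add: map_comp_Some_iff)
qed

lemma strong_limit_product_eq:
  assumes "coherent S" "coherent S'" "coherent T" "coherent T'"
    and "\<And>n. adjoint_pair (S n) (S' n)" "\<And>n. adjoint_pair (T n) (T' n)"
    and "\<And>n x. S' n (S n x) = T' n (T n x)"
  shows "strong_limit S' \<circ>\<^sub>m strong_limit S = strong_limit T' \<circ>\<^sub>m strong_limit T"
proof (rule partial_map_eqI)
  fix x z
  show "(strong_limit S' \<circ>\<^sub>m strong_limit S) x = Some z \<longleftrightarrow>
      (strong_limit T' \<circ>\<^sub>m strong_limit T) x = Some z"
    using strong_limit_product_subset[OF assms]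
      strong_limit_product_subset[OF assms(3,4,1,2) assms(6,5) assms(7)[symmetric]] by blast
qed

lemma strong_limit_normal:
  assumes T: "coherent T" and T': "coherent T'" and adj: "\<And>n. adjoint_pair (T n) (T' n)"
    and comm: "\<And>n x. T n (T' n x) = T' n (T n x)"
  shows "normal_operator (strong_limit T)"
  unfolding normal_operator_def closed_operator_def strong_limit_adjoint[OF T T' adj]
  using strong_limit_linear[OF T] strong_limit_densely_defined[OF T] strong_limit_graph_closed[OF T]
    strong_limit_product_eq[OF T' T T T' adjoint_pair_sym[OF adj] adj comm]
  by simp

end

text \<open>
  Cutting the family \<open>T\<close> down further, by operators \<open>R n\<close> that commute with it and tend to the
  identity, does not change the limit. It serves to regard two operators with different exhaustions
  as limits along a common one.
\<close>

lemma strong_limit_refine: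
  assumes P: "exhaustion P" and T: "exhaustion.coherent P T"
    and Q_exhaustion: "exhaustion Q" and TR: "exhaustion.coherent Q (\<lambda>n x. T n (R n x))"
    and Q: "\<And>n x. Q n x = P n (R n x)"
    and R_tendsto: "\<And>x. (\<lambda>n. R n x) \<longlonglongrightarrow> x"
    and comm: "\<And>n x. T n (R n x) = R n (T n x)" "\<And>n x. P n (R n x) = R n (P n x)"
  shows "strong_limit T = strong_limit (\<lambda>n x. T n (R n x))"
proof (rule partial_map_eqI)
  interpret P: exhaustion P by (rule P)
  interpret Q: exhaustion Q by (rule Q_exhaustion)
  fix x y
  have "(\<forall>n. T n x = P n y) \<longleftrightarrow> (\<forall>n. T n (R n x) = P n (R n y))"
  proof (intro iffI allI)
    fix n assume "\<forall>n. T n x = P n y"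
    then show "T n (R n x) = P n (R n y)" by (simp add: comm)
  next
    fix n assume eq: "\<forall>n. T n (R n x) = P n (R n y)"
    have "T n (R m x) = P n (R m y)" if "n \<le> m" for m
    proof -
      have "P n (T m (R m x)) = P n (P m (R m y))" using eq by simp
      then show ?thesis using that by (simp add: P.coherentD(3)[OF T] P.Q_Q min_absorb1 min_absorb2)
    qed
    then have ev: "\<forall>\<^sub>F m in sequentially. P n (R m y) = T n (R m x)"
      by (intro eventually_sequentiallyI[of n]) simp
    have "(\<lambda>m. T n (R m x)) \<longlonglongrightarrow> T n x"
      by (rule bounded_clinear_tendsto[OF P.coherentD(1)[OF T] R_tendsto])
    moreover have "(\<lambda>m. T n (R m x)) \<longlonglongrightarrow> P n y"
      using bounded_clinear_tendsto[OF P.Q_lin R_tendsto] by (rule Lim_transform_eventually[OF _ ev])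
    ultimately show "T n x = P n y" by (rule LIMSEQ_unique)
  qed
  then show "strong_limit T x = Some y \<longleftrightarrow> strong_limit (\<lambda>n x. T n (R n x)) x = Some y"
    by (simp add: P.strong_limit_eq_Some_iff[OF T] Q.strong_limit_eq_Some_iff[OF TR] Q)
qed

section \<open>Uniqueness of the positive square root\<close>

lemma selfadjoint_cinner:
  assumes "selfadjoint_operator S" "S x = Some u" "S y = Some v"
  shows "cinner u y = cinner x v"
  using assms adjoint_operator_eq_Some_iff[of S y v] by (auto simp: selfadjoint_operator_def)

text \<open>
  With \<open>a k = \<parallel>C\<^sup>k v\<parallel>\<^sup>2\<close>, which decreases, symmetry of \<open>C\<close> gives
  \<open>\<parallel>C\<^sup>2\<^sup>m v - C\<^sup>2\<^sup>n v\<parallel>\<^sup>2 = a (2m) + a (2n) - 2 a (m + n)\<close>. Only even powers converge in general, as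
  \<open>C = - 1\<close> shows.
\<close>

lemma selfadjoint_contraction_powers_converge:
  fixes C :: "'h::complex_hilbert_space \<Rightarrow> 'h"
  assumes C: "bounded_clinear C" and adj: "adjoint_pair C C"
    and contraction: "\<And>x. norm (C x) \<le> norm x"
  shows "\<exists>w. (\<lambda>k. (C ^^ (2 * k)) v) \<longlonglongrightarrow> w \<and> C (C w) = w"
proof -
  define p where "p k = (C ^^ (2 * k)) v" for k
  define a where "a k = (norm ((C ^^ k) v))\<^sup>2" for k
  have shift: "cinner ((C ^^ i) x) y = cinner x ((C ^^ i) y)" for i x y
  proof (induction i arbitrary: y)
    case (Suc i)
    have "cinner ((C ^^ Suc i) x) y = cinner x ((C ^^ i) (C y))"
      by (simp add: adjoint_pairD[OF adj] Suc)
    then show ?case by (simp add: funpow_swap1)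
  qed simp
  have a_dec: "decseq a"
    unfolding decseq_Suc_iff a_def by (auto intro!: power_mono contraction)
  have "bounded (range a)"
  proof (rule boundedI)
    fix r assume "r \<in> range a"
    then obtain k where k: "r = a k" by blast
    have "a k \<le> a 0" using decseqD[OF a_dec, of 0 k] by simp
    then show "norm r \<le> a 0" by (simp add: k a_def)
  qed
  then have "Bseq a" by (simp add: Bseq_eq_bounded)
  then obtain L where aL: "a \<longlonglongrightarrow> L"
    using Bseq_monoseq_convergent[of a] decseq_imp_monoseq[OF a_dec] convergent_def by blast
  have La: "L \<le> a k" for k by (rule decseq_ge[OF a_dec aL])
  have p_cinner: "Re (cinner (p i) (p j)) = a (i + j)" for i j
  proof -
    have "cinner (p i) (p j) = cinner v ((C ^^ (i + j)) ((C ^^ (i + j)) v))"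
    proof -
      have "(C ^^ (2 * i)) ((C ^^ (2 * j)) v) = (C ^^ (2 * i + 2 * j)) v"
        by (simp add: funpow_add)
      also have "2 * i + 2 * j = (i + j) + (i + j)" by simp
      also have "(C ^^ ((i + j) + (i + j))) v = (C ^^ (i + j)) ((C ^^ (i + j)) v)"
        by (subst funpow_add) simp
      finally show ?thesis unfolding p_def shift by simp
    qed
    also have "\<dots> = cinner ((C ^^ (i + j)) v) ((C ^^ (i + j)) v)"
      by (rule shift[symmetric])
    finally show ?thesis by (simp only: a_def norm_square_eq_Re_cinner)
  qed
  have dist_sq: "(norm (p m - p n))\<^sup>2 \<le> 2 * (a (2 * N) - L)" if "N \<le> m" "N \<le> n" for m n N
  proof -
    have "(norm (p m - p n))\<^sup>2 = Re (cinner (p m) (p m)) + Re (cinner (p n) (p n))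
        - Re (cinner (p m) (p n)) - Re (cinner (p n) (p m))"
      by (simp add: norm_square_eq_Re_cinner cinner.diff_left cinner.diff_right)
    also have "\<dots> = a (m + m) + a (n + n) - 2 * a (m + n)"
      by (simp add: p_cinner add.commute)
    also have "\<dots> \<le> 2 * (a (2 * N) - L)"
      using decseqD[OF a_dec, of "2 * N" "m + m"] decseqD[OF a_dec, of "2 * N" "n + n"] La[of "m + n"] that
      by simp
    finally show ?thesis .
  qed
  have "Cauchy p"
  proof (rule metric_CauchyI)
    fix e :: real assume e: "0 < e"
    have "\<forall>\<^sub>F k in sequentially. a k < L + e\<^sup>2 / 2"
      using e by (intro order_tendstoD(2)[OF aL]) simp
    then obtain N where "a N < L + e\<^sup>2 / 2" by (meson eventually_sequentially order_refl)
    then have N: "2 * (a (2 * N) - L) < e\<^sup>2"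
      using decseqD[OF a_dec, of N "2 * N"] by simp
    have "dist (p m) (p n) < e" if "N \<le> m" "N \<le> n" for m n
      unfolding dist_norm using dist_sq[OF that] N e
      by (intro power2_less_imp_less[of _ e]) auto
    then show "\<exists>N. \<forall>m\<ge>N. \<forall>n\<ge>N. dist (p m) (p n) < e" by blast
  qed
  then obtain w where w: "p \<longlonglongrightarrow> w" using Cauchy_convergent convergent_def by blast
  have "(\<lambda>k. C (C (p k))) \<longlonglongrightarrow> C (C w)"
    by (intro bounded_clinear_tendsto[OF C] w)
  moreover have "(\<lambda>k. C (C (p k))) = (\<lambda>k. p (Suc k))"
    by (simp add: p_def)
  ultimately have "C (C w) = w"
    using LIMSEQ_Suc[OF w] LIMSEQ_unique by simp
  then show ?thesis using w unfolding p_def by blast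
qed

context exhaustion
begin

text \<open>
  Uniqueness of the square root without spectral theory for \<open>S\<close>, and without knowing beforehand that
  \<open>S\<close> commutes with \<open>N\<close>. On the range \<open>V\<close> of \<open>Q n\<close> put \<open>d = S - N\<close>. From \<open>S\<^sup>2 = N\<^sup>2\<close> one gets
  \<open>S d = - d N\<close>, hence \<open>(K + S) d = d (K - N)\<close> for each \<open>K > 0\<close>. As \<open>S\<close> is positive,
  \<open>\<parallel>(K + S) a\<parallel> \<ge> K \<parallel>a\<parallel>\<close>, so \<open>\<parallel>d v\<parallel> \<le> \<parallel>d (C v)\<parallel>\<close> with \<open>C = 1 - N / K\<close>. For \<open>K\<close> a bound of \<open>N\<close>,
  this \<open>C\<close> is a selfadjoint contraction, and the even powers of \<open>C\<close> applied to \<open>v\<close> tend to some \<open>w\<close>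
  with \<open>N w = 0\<close>. Both \<open>N\<close> and \<open>S\<close> vanish at \<open>w\<close>, and \<open>d\<close> is bounded on \<open>V\<close>, so iterating the
  inequality gives \<open>d v = 0\<close>.
\<close>

lemma positive_sqrt_on_range:
  assumes N: "coherent N" and N_adj: "\<And>n. adjoint_pair (N n) (N n)"
    and N_pos: "\<And>n x. 0 \<le> Re (cinner (N n x) x)"
    and S: "selfadjoint_operator S" and S_pos: "positive_operator S"
    and sq: "S \<circ>\<^sub>m S = strong_limit N \<circ>\<^sub>m strong_limit N"
  shows "S (Q n x) = Some (N n x)"
proof -
  define V where "V = range (Q n)"
  note N_lin = coherentD(1)[OF N, of n]
  note N_sym = adjoint_pairD[OF N_adj[of n]]
  have N_V: "N n v \<in> V" for v
    unfolding V_def by (rule range_eqI[where x="N n v"]) (simp add: coherentD(3)[OF N])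
  have NQ: "N n (Q n v) = N n v" for v by (simp add: coherentD(2)[OF N])
  have V_diff: "v - r *\<^sub>R w \<in> V" if vw: "v \<in> V" "w \<in> V" for v w r
  proof -
    obtain a b where "v = Q n a" "w = Q n b" using vw by (auto simp: V_def)
    then have "v - r *\<^sub>R w = Q n (a - r *\<^sub>R b)"
      by (simp add: bounded_clinear_diff[OF Q_lin] scaleR_scaleC bounded_clinear_scaleC[OF Q_lin])
    then show ?thesis by (simp add: V_def)
  qed
  have S_lin: "linear_operator S" using S by (simp add: selfadjoint_operator_def)
  obtain K where K: "0 < K" "\<And>v. norm (N n v) \<le> norm v * K"
    using bounded_linear.pos_bounded[OF bounded_clinear_linear[OF N_lin]] by blast
  define f where "f v = the (S v)" for v
  have S_V: "S v = Some (f v)" "S (f v) = Some (N n (N n v))" if vV: "v \<in> V" for v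
  proof -
    obtain u where v: "v = Q n u" using vV by (auto simp: V_def)
    have "strong_limit N v = Some (N n v)"
      using strong_limit_on_range[OF N, of n u] by (simp add: v NQ)
    moreover have "strong_limit N (N n v) = Some (N n (N n v))"
      using strong_limit_on_range[OF N, of n "N n v"] coherentD(3)[OF N, of n n v] by simp
    ultimately have "(S \<circ>\<^sub>m S) v = Some (N n (N n v))"
      unfolding sq by (simp add: map_comp_Some_iff)
    then show "S v = Some (f v)" "S (f v) = Some (N n (N n v))"
      by (auto simp: map_comp_Some_iff f_def)
  qed
  have f_norm: "norm (f v) = norm (N n v)" if "v \<in> V" for v
  proof -
    have "cinner (f v) (f v) = cinner v (N n (N n v))"
      using selfadjoint_cinner[OF S S_V[OF that]] .
    also have "\<dots> = cinner (N n v) (N n v)" by (rule adjoint_pairD[OF N_adj, symmetric])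
    finally show ?thesis by (simp add: norm_eq_sqrt_cinner)
  qed
  have S_comb: "S (a - r *\<^sub>R b) = Some (u - r *\<^sub>R w)" if "S a = Some u" "S b = Some w" for a b u w r
  proof -
    have "S (of_real (- r) *\<^sub>C b) = Some (of_real (- r) *\<^sub>C w)"
      using S_lin that(2) unfolding linear_operator_def by blast
    then have "S ((- r) *\<^sub>R b) = Some ((- r) *\<^sub>R w)" by (simp only: scaleR_scaleC)
    then have "S (a + (- r) *\<^sub>R b) = Some (u + (- r) *\<^sub>R w)"
      using S_lin that(1) unfolding linear_operator_def by blast
    then show ?thesis by simp
  qed
  define d where "d v = f v - N n v" for v
  have N_comb: "N n (v - r *\<^sub>R w) = N n v - r *\<^sub>R N n w" for v r w
    by (simp add: bounded_clinear_diff[OF N_lin] scaleR_scaleC bounded_clinear_scaleC[OF N_lin])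
  have d_comb: "d (v - r *\<^sub>R w) = d v - r *\<^sub>R d w" if "v \<in> V" "w \<in> V" for v w r
  proof -
    have "f (v - r *\<^sub>R w) = f v - r *\<^sub>R f w"
      using S_comb[OF S_V(1)[OF that(1)] S_V(1)[OF that(2)], of r] by (simp add: f_def)
    then show ?thesis by (simp add: d_def N_comb algebra_simps)
  qed
  have d_bound: "norm (d v) \<le> 2 * K * norm v" if "v \<in> V" for v
    using norm_triangle_ineq4[of "f v" "N n v"] f_norm[OF that] K(2)[of v]
    by (simp add: d_def mult_ac)
  have S_d: "S (d v) = Some (- d (N n v))" if "v \<in> V" for v
    using S_comb[OF S_V(2)[OF that] S_V(1)[OF N_V[of v]], of 1] by (simp add: d_def)
  define C where "C v = v - (1 / K) *\<^sub>R N n v" for v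
  have C_V: "C v \<in> V" if "v \<in> V" for v
    unfolding C_def by (rule V_diff[OF that N_V])
  have d_le: "norm (d v) \<le> norm (d (C v))" if "v \<in> V" for v
  proof -
    let ?a = "d v" and ?b = "- d (N n v)"
    have "0 \<le> Re (cinner ?b ?a)"
      using S_pos S_d[OF that] unfolding positive_operator_def by blast
    then have "K * (norm ?a)\<^sup>2 \<le> Re (cinner (K *\<^sub>R ?a + ?b) ?a)"
      unfolding cinner_add_left cinner.scaleR_left norm_square_eq_Re_cinner by simp
    also have "\<dots> \<le> norm (K *\<^sub>R ?a + ?b) * norm ?a"
      using complex_Re_le_cmod cinner_cauchy_schwarz order_trans by blast
    also have "K *\<^sub>R ?a + ?b = K *\<^sub>R d (C v)"
      using K(1) by (simp add: C_def d_comb[OF that N_V] algebra_simps)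
    also have "norm \<dots> = K * norm (d (C v))" using K(1) by simp
    finally have "norm ?a * norm ?a \<le> norm (d (C v)) * norm ?a"
      using K(1) by (simp add: power2_eq_square)
    then show ?thesis by (cases "norm ?a = 0") (auto simp: mult_le_cancel_right)
  qed
  have pow_V: "(C ^^ k) v \<in> V" if "v \<in> V" for v k
    by (induction k) (simp_all add: that C_V)
  have d_pow: "norm (d v) \<le> norm (d ((C ^^ k) v))" if "v \<in> V" for v k
  proof (induction k)
    case (Suc k)
    then show ?case using d_le[OF pow_V[OF that, of k]] by simp
  qed simp
  \<comment> \<open>Expand \<open>0 \<le> \<langle>N w, w\<rangle>\<close> at \<open>w = v - N v / K\<close>.\<close>
  have N_sq: "(norm (N n v))\<^sup>2 \<le> K * Re (cinner (N n v) v)" for v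
  proof -
    let ?w = "v - (1 / K) *\<^sub>R N n v"
    have "Re (cinner (N n (N n v)) (N n v)) \<le> norm (N n (N n v)) * norm (N n v)"
      using complex_Re_le_cmod cinner_cauchy_schwarz order_trans by blast
    also have "\<dots> \<le> (norm (N n v) * K) * norm (N n v)"
      by (intro mult_right_mono K) simp
    finally have "Re (cinner (N n (N n v)) (N n v)) \<le> K * (norm (N n v))\<^sup>2"
      by (simp add: power2_eq_square mult_ac)
    moreover have "Re (cinner (N n ?w) ?w) = Re (cinner (N n v) v) - 2 / K * (norm (N n v))\<^sup>2
        + 1 / K\<^sup>2 * Re (cinner (N n (N n v)) (N n v))"
      unfolding norm_square_eq_Re_cinner
      by (simp add: N_comb cinner.diff_left cinner.diff_right cinner.scaleR_left cinner.scaleR_right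
          N_sym[of "N n v" v] power2_eq_square algebra_simps)
    moreover have "0 \<le> Re (cinner (N n ?w) ?w)" by (rule N_pos)
    moreover have "1 / K\<^sup>2 * Re (cinner (N n (N n v)) (N n v)) \<le> 1 / K\<^sup>2 * (K * (norm (N n v))\<^sup>2)"
      by (intro mult_left_mono calculation(1)) simp
    ultimately have "0 \<le> Re (cinner (N n v) v) - 2 / K * (norm (N n v))\<^sup>2 + 1 / K\<^sup>2 * (K * (norm (N n v))\<^sup>2)"
      by linarith
    then show ?thesis using K(1) by (simp add: field_simps power2_eq_square)
  qed
  have C_lin: "bounded_clinear C"
  proof -
    have "bounded_clinear (\<lambda>v::'h. v)"
      by (rule orthogonal_projection_bounded_clinear) (simp add: orthogonal_projection_def)
    from bounded_clinear_sum[OF this bounded_clinear_scale[OF N_lin, of "of_real (- (1/K))"]]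
    have "bounded_clinear (\<lambda>v. v + (- (1/K)) *\<^sub>R N n v)" by (simp only: scaleR_scaleC)
    then show ?thesis by (simp add: C_def[abs_def])
  qed
  have C_adj: "adjoint_pair C C"
    by (simp add: adjoint_pair_def C_def cinner.diff_left cinner.diff_right cinner.scaleR_left
        cinner.scaleR_right N_sym)
  have C_contraction: "norm (C v) \<le> norm v" for v
  proof -
    have "(norm (C v))\<^sup>2 = (norm v)\<^sup>2 - 2 / K * Re (cinner (N n v) v) + 1 / K\<^sup>2 * (norm (N n v))\<^sup>2"
      unfolding norm_square_eq_Re_cinner
      by (simp add: C_def cinner.diff_left cinner.diff_right cinner.scaleR_left cinner.scaleR_right
          N_sym[of v v, symmetric] power2_eq_square algebra_simps)
    also have "\<dots> \<le> (norm v)\<^sup>2 - 2 / K * Re (cinner (N n v) v) + 1 / K\<^sup>2 * (K * Re (cinner (N n v) v))"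
      by (intro add_left_mono mult_left_mono N_sq) simp
    also have "\<dots> \<le> (norm v)\<^sup>2"
      using K(1) N_pos[of n v] by (simp add: field_simps power2_eq_square)
    finally show ?thesis by (rule power2_le_imp_le) simp
  qed
  have d0: "d v = 0" if v: "v \<in> V" for v
  proof -
    obtain w where w: "(\<lambda>k. (C ^^ (2 * k)) v) \<longlonglongrightarrow> w" and Cw: "C (C w) = w"
      using selfadjoint_contraction_powers_converge[OF C_lin C_adj C_contraction] by blast
    have "(\<lambda>k. Q n ((C ^^ (2 * k)) v)) \<longlonglongrightarrow> Q n w"
      by (rule bounded_clinear_tendsto[OF Q_lin w])
    moreover have "Q n ((C ^^ (2 * k)) v) = (C ^^ (2 * k)) v" for k
      using pow_V[OF v, of "2 * k"] by (auto simp: V_def Q_Q)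
    ultimately have "w = Q n w" using w LIMSEQ_unique by simp
    then have wV: "w \<in> V" unfolding V_def by (rule range_eqI)
    \<comment> \<open>\<open>C\<^sup>2 w = w\<close> reads \<open>2 N w = N\<^sup>2 w / K\<close>, and the right-hand side has norm at most \<open>\<parallel>N w\<parallel>\<close>.\<close>
    have "2 *\<^sub>R N n w = (1 / K) *\<^sub>R N n (N n w)"
    proof -
      have "w = w - (1 / K) *\<^sub>R N n w - (1 / K) *\<^sub>R (N n w - (1 / K) *\<^sub>R N n (N n w))"
        using Cw by (simp add: C_def N_comb)
      then have "(1 / K) *\<^sub>R (2 *\<^sub>R N n w - (1 / K) *\<^sub>R N n (N n w)) = 0"
        by (simp add: algebra_simps scaleR_2)
      then show ?thesis using K(1) by simp
    qed
    then have "2 * norm (N n w) = (1 / K) * norm (N n (N n w))"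
      using K(1) by (metis abs_of_pos norm_scaleR zero_less_divide_1_iff zero_less_numeral)
    also have "\<dots> \<le> (1 / K) * (norm (N n w) * K)"
      using K by (intro mult_left_mono) auto
    finally have "N n w = 0" using K(1) by simp
    then have dw: "d w = 0" using f_norm[OF wV] by (simp add: d_def)
    have "norm (d v) \<le> 2 * K * norm ((C ^^ (2 * k)) v - w)" for k
    proof -
      have "norm (d v) \<le> norm (d ((C ^^ (2 * k)) v))" by (rule d_pow[OF v])
      also have "d ((C ^^ (2 * k)) v) = d ((C ^^ (2 * k)) v - 1 *\<^sub>R w)"
        by (subst d_comb[OF pow_V[OF v] wV]) (simp add: dw)
      also have "norm \<dots> \<le> 2 * K * norm ((C ^^ (2 * k)) v - w)"
        using d_bound[OF V_diff[OF pow_V[OF v] wV, of _ 1]] by simp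
      finally show ?thesis .
    qed
    moreover have "(\<lambda>k. 2 * K * norm ((C ^^ (2 * k)) v - w)) \<longlonglongrightarrow> 2 * K * norm (w - w)"
      by (intro tendsto_intros w)
    ultimately have "norm (d v) \<le> 2 * K * norm (w - w)"
      by (intro LIMSEQ_le_const) auto
    then show ?thesis by simp
  qed
  have "Q n x \<in> V" by (simp add: V_def)
  then show ?thesis using d0[of "Q n x"] S_V(1) by (simp add: d_def NQ)
qed

text \<open>
  Agreement on the ranges of the \<open>Q n\<close> suffices because both operators are selfadjoint. Testing
  \<open>S x = y\<close> against the vectors \<open>Q n w\<close> gives \<open>N n x = Q n y\<close>. Conversely, if \<open>N n x = Q n y\<close> for all
  \<open>n\<close>, then \<open>\<langle>S v, Q n x\<rangle> = \<langle>v, Q n y\<rangle>\<close> passes to the limit, so that \<open>x\<close> lies in the domain of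
  \<open>S\<^sup>* = S\<close>.
\<close>

lemma positive_sqrt_unique:
  assumes N: "coherent N" and N_adj: "\<And>n. adjoint_pair (N n) (N n)"
    and N_pos: "\<And>n x. 0 \<le> Re (cinner (N n x) x)"
    and S: "selfadjoint_operator S" and S_pos: "positive_operator S"
    and sq: "S \<circ>\<^sub>m S = strong_limit N \<circ>\<^sub>m strong_limit N"
  shows "S = strong_limit N"
proof (rule partial_map_eqI)
  note range = positive_sqrt_on_range[OF assms]
  have dense: "densely_defined S" and self: "adjoint_operator S = S"
    using S by (simp_all add: selfadjoint_operator_def)
  fix x y
  show "S x = Some y \<longleftrightarrow> strong_limit N x = Some y"
  proof
    assume xy: "S x = Some y"
    have "cinner w (N n x) = cinner w (Q n y)" for n w
      using selfadjoint_cinner[OF S range[of n w] xy] adjoint_pairD[OF N_adj] adjoint_pairD[OF Q_adj]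
      by metis
    then have "N n x = Q n y" for n by (rule cinner_ext)
    then show "strong_limit N x = Some y" by (simp add: strong_limit_eq_Some_iff[OF N])
  next
    assume "strong_limit N x = Some y"
    then have xy: "N n x = Q n y" for n by (simp add: strong_limit_eq_Some_iff[OF N])
    have "cinner u x = cinner v y" if "S v = Some u" for u v
    proof -
      have "cinner u (Q n x) = cinner v (Q n y)" for n
        using selfadjoint_cinner[OF S that range[of n x]] by (simp add: xy)
      moreover have "(\<lambda>n. cinner u (Q n x)) \<longlonglongrightarrow> cinner u x" "(\<lambda>n. cinner v (Q n y)) \<longlonglongrightarrow> cinner v y"
        by (intro cinner.tendsto tendsto_const Q_tendsto)+
      ultimately show ?thesis using LIMSEQ_unique by simp
    qed
    then have "adjoint_operator S x = Some y"
      by (simp add: adjoint_operator_eq_Some_iff[OF dense])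
    then show "S x = Some y" by (simp add: self)
  qed
qed

lemma strong_limit_selfadjoint:
  assumes "coherent N" "\<And>n. adjoint_pair (N n) (N n)"
  shows "selfadjoint_operator (strong_limit N)"
  using assms by (simp add: selfadjoint_operator_def strong_limit_linear strong_limit_densely_defined
      strong_limit_adjoint)

lemma strong_limit_positive:
  assumes adj: "\<And>n. adjoint_pair (N n) (N n)" and pos: "\<And>n x. 0 \<le> Re (cinner (N n x) x)"
  shows "positive_operator (strong_limit N)"
  unfolding positive_operator_def
proof (intro allI impI)
  fix x u assume "strong_limit N x = Some u"
  then have lim: "(\<lambda>n. cinner (N n x) x) \<longlonglongrightarrow> cinner u x"
    by (intro cinner.tendsto tendsto_const) (simp add: strong_limit_eq_Some_iff_tendsto)
  have "cinner (N n x) x \<in> \<real>" for n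
    using cinner_commute[of "N n x" x] by (simp add: adjoint_pairD[OF adj, of n x x] Reals_cnj_iff)
  then have "cinner u x \<in> \<real>"
    by (intro closed_sequentially[OF closed_complex_Reals _ lim])
  moreover have "0 \<le> Re (cinner u x)"
    by (rule LIMSEQ_le_const[OF tendsto_Re[OF lim]]) (use pos in auto)
  ultimately show "cinner u x \<in> \<real> \<and> 0 \<le> Re (cinner u x)" ..
qed

lemma abs_operator_strong_limit:
  assumes T: "coherent T" and T': "coherent T'" and adj: "\<And>n. adjoint_pair (T n) (T' n)"
    and N: "coherent N" and N_adj: "\<And>n. adjoint_pair (N n) (N n)"
    and N_pos: "\<And>n x. 0 \<le> Re (cinner (N n x) x)"
    and sq: "\<And>n x. N n (N n x) = T' n (T n x)"
  shows "abs_operator (strong_limit T) = strong_limit N"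
proof -
  have eq: "strong_limit N \<circ>\<^sub>m strong_limit N = adjoint_operator (strong_limit T) \<circ>\<^sub>m strong_limit T"
    unfolding strong_limit_adjoint[OF T T' adj]
    by (rule strong_limit_product_eq[OF N N T T' N_adj adj sq])
  show ?thesis
    unfolding abs_operator_def
  proof (rule the_equality)
    show "selfadjoint_operator (strong_limit N) \<and> positive_operator (strong_limit N) \<and>
        strong_limit N \<circ>\<^sub>m strong_limit N = adjoint_operator (strong_limit T) \<circ>\<^sub>m strong_limit T"
      using strong_limit_selfadjoint[OF N N_adj] strong_limit_positive[of N, OF N_adj N_pos] eq by blast
  next
    fix S assume "selfadjoint_operator S \<and> positive_operator S \<and>
      S \<circ>\<^sub>m S = adjoint_operator (strong_limit T) \<circ>\<^sub>m strong_limit T"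
    then show "S = strong_limit N"
      using positive_sqrt_unique[OF N N_adj N_pos, of S] by (simp add: eq)
  qed
qed

end

section \<open>Joint functional calculus of two commuting spectral measures\<close>

text \<open>
  Unbounded functions are handled through their restrictions to balls, which are bounded for the
  functions of interest.
\<close>

definition cutoff :: "(complex \<Rightarrow> complex) \<Rightarrow> nat \<Rightarrow> complex \<Rightarrow> complex" where
  "cutoff f n z = f z * indicator (cball 0 (real n)) z"

definition locally_bounded_borel :: "(complex \<Rightarrow> complex) \<Rightarrow> bool" where
  "locally_bounded_borel f \<longleftrightarrow> (\<forall>n. bounded_borel (cutoff f n))"

lemma cutoff_mult: "cutoff f m z * cutoff g n z = cutoff (\<lambda>z. f z * g z) (min m n) z"
  by (auto simp: cutoff_def split: split_indicator)

lemma cutoff_cnj: "cnj (cutoff f n z) = cutoff (\<lambda>z. cnj (f z)) n z"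
  by (auto simp: cutoff_def split: split_indicator)

lemma cutoff_one: "cutoff (\<lambda>_. 1) n = indicator (cball 0 (real n))"
  by (auto simp: cutoff_def)

lemma locally_bounded_borelD: "locally_bounded_borel f \<Longrightarrow> bounded_borel (cutoff f n)"
  by (simp add: locally_bounded_borel_def)

lemma locally_bounded_borel_continuous:
  assumes "continuous_on UNIV f"
  shows "locally_bounded_borel f"
  unfolding locally_bounded_borel_def
proof
  fix n
  have "bounded (f ` cball 0 (real n))"
    by (intro compact_imp_bounded compact_continuous_image continuous_on_subset[OF assms]) auto
  then obtain C where C: "\<And>z. z \<in> cball 0 (real n) \<Longrightarrow> cmod (f z) \<le> C"
    unfolding bounded_iff by blast
  show "bounded_borel (cutoff f n)"
  proof (rule bounded_borelI[where C="max 0 C"])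
    have "f \<in> borel_measurable borel" by (rule borel_measurable_continuous_onI[OF assms])
    then show "cutoff f n \<in> borel_measurable borel"
      unfolding cutoff_def[abs_def]
      by (intro borel_measurable_times bounded_borel_measurable[OF bounded_borel_indicator]) auto
    show "cmod (cutoff f n z) \<le> max 0 C" for z
      using C[of z] by (auto simp: cutoff_def split: split_indicator)
  qed
qed

lemma locally_bounded_borel_cnj:
  assumes "locally_bounded_borel f"
  shows "locally_bounded_borel (\<lambda>z. cnj (f z))"
  unfolding locally_bounded_borel_def
proof
  fix n
  show "bounded_borel (cutoff (\<lambda>z. cnj (f z)) n)"
    using bounded_borel_cnj[OF locally_bounded_borelD[OF assms, of n]] by (simp add: cutoff_cnj)
qed

lemma bounded_borel_cmod: "bounded_borel f \<Longrightarrow> bounded_borel (\<lambda>z. of_real (cmod (f z)))"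
  by (rule bounded_borel_dominated[of f]) (auto dest: bounded_borel_measurable)

lemma bounded_borel_sqrt_cmod: "bounded_borel f \<Longrightarrow> bounded_borel (\<lambda>z. of_real (sqrt (cmod (f z))))"
proof -
  assume f: "bounded_borel f"
  then obtain C where C: "\<And>z. cmod (f z) \<le> C" unfolding bounded_borel_def by blast
  have "cmod (of_real (sqrt (cmod (f z)))) \<le> sqrt C" for z
    using C[of z] by simp
  then show ?thesis using bounded_borel_measurable[OF f]
    by (intro bounded_borelI[where C="sqrt C"]) simp_all
qed

lemma cutoff_cmod: "cutoff (\<lambda>z. of_real (cmod (f z))) n z = of_real (cmod (cutoff f n z))"
  by (auto simp: cutoff_def split: split_indicator)

lemma locally_bounded_borel_cmod:
  assumes "locally_bounded_borel f"
  shows "locally_bounded_borel (\<lambda>z. of_real (cmod (f z)))"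
  unfolding locally_bounded_borel_def
proof
  fix n
  show "bounded_borel (cutoff (\<lambda>z. of_real (cmod (f z))) n)"
    using bounded_borel_cmod[OF locally_bounded_borelD[OF assms, of n]]
    by (simp add: cutoff_cmod[abs_def])
qed

context pvm
begin

lemma E_cball_tendsto: "(\<lambda>n. E (cball 0 (real n)) x) \<longlonglongrightarrow> x"
proof -
  let ?M = "\<lambda>n::nat. - cball 0 (real n) :: complex set"
  have empty: "(\<Inter>n. ?M n) = {}"
  proof -
    have "\<exists>n. z \<in> cball 0 (real n)" for z :: complex
      using real_arch_simple[of "cmod z"] by (auto simp: dist_norm)
    then show ?thesis by blast
  qed
  have "decseq ?M" by (auto simp: decseq_def)
  then have "(\<lambda>n. measure (\<mu> x) (?M n)) \<longlonglongrightarrow> measure (\<mu> x) (\<Inter>n. ?M n)"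
    by (intro finite_measure.finite_Lim_measure_decseq[OF finite_measure_mu]) auto
  then have "(\<lambda>n. (norm (x - E (cball 0 (real n)) x))\<^sup>2) \<longlonglongrightarrow> 0"
    unfolding empty by (simp add: measure_mu E_Compl)
  then have "(\<lambda>n. sqrt ((norm (x - E (cball 0 (real n)) x))\<^sup>2)) \<longlonglongrightarrow> sqrt 0"
    by (rule tendsto_real_sqrt)
  then have "(\<lambda>n. x - E (cball 0 (real n)) x) \<longlonglongrightarrow> 0"
    by (simp add: tendsto_norm_zero_iff)
  from tendsto_diff[OF tendsto_const[of x] this] show ?thesis by simp
qed

lemma exhaustion_cball: "exhaustion (\<lambda>n. E (cball 0 (real n)))"
proof
  fix m n :: nat and x :: 'h
  have "cball 0 (real m) \<inter> cball 0 (real n) = (cball 0 (real (min m n)) :: complex set)"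
    by (auto simp: min_def)
  then show "E (cball 0 (real m)) (E (cball 0 (real n)) x) = E (cball 0 (real (min m n))) x"
    by (simp add: E_Int)
qed (simp_all add: projection E_cball_tendsto)

lemma Phi_cutoff_one: "\<Phi> (cutoff (\<lambda>_. 1) n) = E (cball 0 (real n))"
  by (simp add: cutoff_one Phi_indicator)

lemma Phi_cutoff_mult:
  assumes "locally_bounded_borel f" "locally_bounded_borel g"
  shows "\<Phi> (cutoff f m) (\<Phi> (cutoff g n) x) = \<Phi> (cutoff (\<lambda>z. f z * g z) (min m n)) x"
  using Phi_mult[OF assms[THEN locally_bounded_borelD]] by (simp add: cutoff_mult)

lemma cutoff_coherent:
  assumes "locally_bounded_borel f"
  shows "exhaustion.coherent (\<lambda>n. E (cball 0 (real n))) (\<lambda>n. \<Phi> (cutoff f n))"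
  unfolding exhaustion.coherent_def[OF exhaustion_cball]
proof -
  have one: "locally_bounded_borel (\<lambda>_. 1)"
    by (intro locally_bounded_borel_continuous continuous_intros)
  show "(\<forall>n. bounded_clinear (\<Phi> (cutoff f n))) \<and>
      (\<forall>m n x. \<Phi> (cutoff f m) (E (cball 0 (real n)) x) = \<Phi> (cutoff f (min m n)) x) \<and>
      (\<forall>m n x. E (cball 0 (real n)) (\<Phi> (cutoff f m) x) = \<Phi> (cutoff f (min m n)) x)"
    using Phi_cutoff_mult[OF assms one] Phi_cutoff_mult[OF one assms]
    by (simp add: Phi_bounded_clinear locally_bounded_borelD[OF assms] Phi_cutoff_one min.commute)
qed

text \<open>
  Both operators have the same domain: \<open>\<parallel>T n x\<parallel>\<^sup>2\<close> is the integral of \<open>\<bar>z\<bar>\<^sup>2\<close> over the ball of radius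
  \<open>n\<close>, so that \<open>T n x\<close> converges precisely if \<open>\<bar>z\<bar>\<^sup>2\<close> is integrable. On it they have the same
  quadratic form \<open>\<integral> z d\<mu> x\<close>, hence agree by polarization and density.
\<close>

lemma spectral_strong_limit:
  assumes spec: "is_spectral_measure A E" and A_lin: "linear_operator A"
    and A_dense: "densely_defined A"
  shows "A = strong_limit (\<lambda>n. \<Phi> (cutoff (\<lambda>z. z) n))"
proof -
  interpret ex: exhaustion "\<lambda>n. E (cball 0 (real n))" by (rule exhaustion_cball)
  define T where "T n = \<Phi> (cutoff (\<lambda>z. z) n)" for n
  have ident: "locally_bounded_borel (\<lambda>z. z)"
    by (intro locally_bounded_borel_continuous continuous_intros)
  note bb = locally_bounded_borelD[OF ident]
  have meas: "cutoff (\<lambda>z. z) n \<in> borel_measurable borel" for n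
    by (rule bounded_borel_measurable[OF bb])
  have T: "ex.coherent T"
    using cutoff_coherent[OF ident] by (simp add: T_def[abs_def])
  have T_norm: "(norm (T n x))\<^sup>2 = (\<integral>z. (cmod (cutoff (\<lambda>z. z) n z))\<^sup>2 \<partial>\<mu> x)" for n x
    unfolding T_def by (rule Phi_norm_square[OF bb])
  have cut_le: "cmod (cutoff (\<lambda>z. z) n z) \<le> cmod z" for n z
    by (auto simp: cutoff_def split: split_indicator)
  have cut_tendsto: "(\<lambda>n. cutoff (\<lambda>z. z) n z) \<longlonglongrightarrow> z" for z
  proof (rule tendsto_eventually, rule eventually_sequentiallyI)
    fix n assume "nat \<lceil>cmod z\<rceil> \<le> n"
    then have "cmod z \<le> real n" by linarith
    then show "cutoff (\<lambda>z. z) n z = z" by (simp add: cutoff_def)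
  qed
  have cut_mono: "cmod (cutoff (\<lambda>z. z) m z) \<le> cmod (cutoff (\<lambda>z. z) n z)" if "m \<le> n" for m n z
    using that by (auto simp: cutoff_def split: split_indicator)
  have dom_A: "x \<in> dom A \<longleftrightarrow> (\<integral>\<^sup>+z. ennreal ((cmod z)\<^sup>2) \<partial>\<mu> x) < \<infinity>" for x
    using spec by (auto simp: is_spectral_measure_def)
  have dom_le: "x \<in> dom A" if "strong_limit T x = Some y" for x y
  proof -
    have Ty: "T n x = E (cball 0 (real n)) y" for n
      using that by (simp add: ex.strong_limit_eq_Some_iff[OF T])
    have "(\<lambda>n. \<integral>\<^sup>+z. ennreal ((cmod (cutoff (\<lambda>z. z) n z))\<^sup>2) \<partial>\<mu> x) \<longlonglongrightarrow> (\<integral>\<^sup>+z. ennreal ((cmod z)\<^sup>2) \<partial>\<mu> x)"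
    proof (rule nn_integral_LIMSEQ)
      show "incseq (\<lambda>n z. ennreal ((cmod (cutoff (\<lambda>z. z) n z))\<^sup>2))"
        by (auto simp: incseq_def le_fun_def intro!: ennreal_leI power_mono cut_mono)
      show "(\<lambda>n. ennreal ((cmod (cutoff (\<lambda>z. z) n z))\<^sup>2)) \<longlonglongrightarrow> ennreal ((cmod z)\<^sup>2)" for z
        by (intro tendsto_intros cut_tendsto)
    qed (use meas in auto)
    moreover have "(\<integral>\<^sup>+z. ennreal ((cmod (cutoff (\<lambda>z. z) n z))\<^sup>2) \<partial>\<mu> x) \<le> ennreal ((norm y)\<^sup>2)" for n
    proof -
      have "integrable (\<mu> x) (\<lambda>z. (cmod (cutoff (\<lambda>z. z) n z))\<^sup>2)"
        using integrable_norm[OF bounded_borel_integrable[OF bounded_borel_mult[OF bb bb]]]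
        by (simp add: norm_mult power2_eq_square)
      then have "(\<integral>\<^sup>+z. ennreal ((cmod (cutoff (\<lambda>z. z) n z))\<^sup>2) \<partial>\<mu> x) = ennreal ((norm (T n x))\<^sup>2)"
        unfolding T_norm by (intro nn_integral_eq_integral) auto
      also have "\<dots> \<le> ennreal ((norm y)\<^sup>2)"
        unfolding Ty by (intro ennreal_leI power_mono E_norm_le) auto
      finally show ?thesis .
    qed
    ultimately have "(\<integral>\<^sup>+z. ennreal ((cmod z)\<^sup>2) \<partial>\<mu> x) \<le> ennreal ((norm y)\<^sup>2)"
      by (intro LIMSEQ_le_const2) auto
    also have "\<dots> < \<infinity>" by simp
    finally show ?thesis by (simp add: dom_A)
  qed
  have both: "\<exists>y. strong_limit T x = Some y \<and> cinner y x = cinner u x" if "A x = Some u" for x u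
  proof -
    have fin: "(\<integral>\<^sup>+z. ennreal ((cmod z)\<^sup>2) \<partial>\<mu> x) < \<infinity>" using that dom_A by blast
    have int: "integrable (\<mu> x) (\<lambda>z. (cmod z)\<^sup>2)"
      by (rule integrableI_bounded) (use fin in auto)
    define I where "I = (\<integral>z. (cmod z)\<^sup>2 \<partial>\<mu> x)"
    have lim: "(\<lambda>n. (norm (T n x))\<^sup>2) \<longlonglongrightarrow> I"
      unfolding T_norm I_def
    proof (rule integral_dominated_convergence[where w="\<lambda>z. (cmod z)\<^sup>2", OF _ _ int])
      show "AE z in \<mu> x. (\<lambda>n. (cmod (cutoff (\<lambda>z. z) n z))\<^sup>2) \<longlonglongrightarrow> (cmod z)\<^sup>2"
        by (intro AE_I2 tendsto_intros cut_tendsto)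
      show "AE z in \<mu> x. norm ((cmod (cutoff (\<lambda>z. z) n z))\<^sup>2) \<le> (cmod z)\<^sup>2" for n
        by (intro AE_I2) (simp add: power_mono cut_le)
    qed (use meas in auto)
    have dist: "(norm (T m x - T n x))\<^sup>2 = (norm (T m x))\<^sup>2 - (norm (T n x))\<^sup>2" if "n \<le> m" for m n
    proof -
      have Q: "T n x = E (cball 0 (real n)) (T m x)"
        using that by (simp add: ex.coherentD(3)[OF T] min_absorb2)
      have "cinner (T n x) (T m x) = of_real ((norm (T n x))\<^sup>2)"
        unfolding Q by (rule E_cinner_self) simp
      then show ?thesis
        using norm_add_square[of "T m x - T n x" "T n x"] cinner_commute[of "T m x" "T n x"]
        by (simp add: cinner.diff_left cinner_self)
    qed
    have le_I: "(norm (T n x))\<^sup>2 \<le> I" for n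
    proof (rule incseq_le[OF _ lim], rule incseq_SucI)
      show "(norm (T m x))\<^sup>2 \<le> (norm (T (Suc m) x))\<^sup>2" for m
        using dist[of m "Suc m"] zero_le_power2[of "norm (T (Suc m) x - T m x)"] by simp
    qed
    have "Cauchy (\<lambda>n. T n x)"
    proof (rule CauchyI')
      fix e :: real assume e: "0 < e"
      have "\<forall>\<^sub>F n in sequentially. I - (e/2)\<^sup>2 < (norm (T n x))\<^sup>2"
        using e by (intro order_tendstoD(1)[OF lim]) simp
      then obtain N where N: "I - (e/2)\<^sup>2 < (norm (T N x))\<^sup>2"
        by (meson eventually_sequentially order_refl)
      have near: "norm (T m x - T N x) < e/2" if "N \<le> m" for m
        using dist[OF that] le_I[of m] N e by (intro power2_less_imp_less[of _ "e/2"]) auto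
      have "dist (T m x) (T n x) < e" if "N \<le> m" "m < n" for m n
        using near[of m] near[of n] that norm_triangle_ineq4[of "T m x - T N x" "T n x - T N x"]
        by (simp add: dist_norm)
      then show "\<exists>M. \<forall>m\<ge>M. \<forall>n>m. dist (T m x) (T n x) < e" by blast
    qed
    then obtain y where y: "(\<lambda>n. T n x) \<longlonglongrightarrow> y" using Cauchy_convergent convergent_def by blast
    have "(\<lambda>n. cinner (T n x) x) \<longlonglongrightarrow> cinner y x"
      by (intro cinner.tendsto y tendsto_const)
    moreover have "(\<lambda>n. cinner (T n x) x) \<longlonglongrightarrow> (\<integral>z. z \<partial>\<mu> x)"
      unfolding T_def Phi_cinner[OF bb]
    proof (rule integral_dominated_convergence[where w="\<lambda>z. 1 + (cmod z)\<^sup>2"])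
      show "integrable (\<mu> x) (\<lambda>z. 1 + (cmod z)\<^sup>2)"
        using int by (simp add: finite_measure.integrable_const[OF finite_measure_mu])
      show "AE z in \<mu> x. (\<lambda>n. cutoff (\<lambda>z. z) n z) \<longlonglongrightarrow> z"
        by (intro AE_I2 cut_tendsto)
      have "r \<le> 1 + r\<^sup>2" for r :: real
        using zero_le_power2[of "r - 1/2"] by (simp add: power2_diff power2_eq_square algebra_simps)
      then show "AE z in \<mu> x. norm (cutoff (\<lambda>z. z) n z) \<le> 1 + (cmod z)\<^sup>2" for n
        using cut_le order_trans by (intro AE_I2) blast
    qed (use meas in auto)
    ultimately have "cinner y x = (\<integral>z. z \<partial>\<mu> x)" by (rule LIMSEQ_unique)
    moreover have "cinner u x = (\<integral>z. z \<partial>\<mu> x)"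
      using spec \<open>A x = Some u\<close> by (simp add: is_spectral_measure_def)
    ultimately show ?thesis using y by (auto simp: strong_limit_eq_Some_iff_tendsto)
  qed
  have L_lin: "linear_operator (strong_limit T)" by (rule ex.strong_limit_linear[OF T])
  have agree: "u = v" if xu: "A x = Some u" and xv: "strong_limit T x = Some v" for x u v
  proof -
    have diag: "cinner (a - b) w = 0" if "A w = Some a" "strong_limit T w = Some b" for w a b
      using both[OF that(1)] that(2) by (auto simp: cinner.diff_left)
    have "cinner (u - v) y = 0" if "y \<in> dom A" for y
    proof -
      obtain a where a: "A y = Some a" using \<open>y \<in> dom A\<close> by blast
      then obtain b where b: "strong_limit T y = Some b" using both by blast
      have comb: "cinner ((u - v) + c *\<^sub>C (a - b)) (x + c *\<^sub>C y) = 0" for c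
      proof -
        have "A (x + c *\<^sub>C y) = Some (u + c *\<^sub>C a)"
          using A_lin xu a unfolding linear_operator_def by blast
        moreover have "strong_limit T (x + c *\<^sub>C y) = Some (v + c *\<^sub>C b)"
          using L_lin xv b unfolding linear_operator_def by blast
        moreover have "(u - v) + c *\<^sub>C (a - b) = (u + c *\<^sub>C a) - (v + c *\<^sub>C b)"
          using scaleC_add_right[of c "a - b" b] by (simp add: algebra_simps)
        ultimately show ?thesis using diag by metis
      qed
      show ?thesis
        by (rule polarization_zero[of _ x "a - b"])
          (use diag[OF xu xv] diag[OF a b] comb[of 1] comb[of \<i>] in \<open>simp_all add: scaleC_one\<close>)
    qed
    then have "u - v = 0"
      by (rule orthogonal_dense_imp_zero[OF A_dense[unfolded densely_defined_def]])
    then show "u = v" by simp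
  qed
  have "A = strong_limit T"
  proof (rule partial_map_eqI)
    fix x y show "A x = Some y \<longleftrightarrow> strong_limit T x = Some y"
      using agree both dom_le by (metis domD)
  qed
  then show ?thesis by (simp add: T_def[abs_def])
qed

end

locale commuting_pvms = E: pvm E + F: pvm F
  for E F :: "complex set \<Rightarrow> 'h::complex_hilbert_space \<Rightarrow> 'h" +
  assumes E_F_commute: "M \<in> sets borel \<Longrightarrow> N \<in> sets borel \<Longrightarrow> E M (F N x) = F N (E M x)"
begin

text \<open>
  The commutation property of the calculus is used twice: first \<open>F N\<close> commutes with \<open>E.\<Phi> f\<close>,
  then \<open>E.\<Phi> f\<close> commutes with \<open>F.\<Phi> g\<close>.
\<close>

lemma Phi_commute_Phi:
  assumes f: "bounded_borel f" and g: "bounded_borel g"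
  shows "E.\<Phi> f (F.\<Phi> g x) = F.\<Phi> g (E.\<Phi> f x)"
proof (rule F.Phi_commute[OF g E.Phi_bounded_clinear[OF f]])
  show "E.\<Phi> f (F N y) = F N (E.\<Phi> f y)" if "N \<in> sets borel" for N y
    using E.Phi_commute[OF f F.E_bounded_clinear[OF that]] E_F_commute that by simp
qed

text \<open>
  The operator \<open>\<integral> f(z) g(w) d(E \<otimes> F)(z, w)\<close>. Functions of this product form are closed under
  multiplication, conjugation and moduli, so that no product spectral measure is needed.
\<close>

definition joint :: "(complex \<Rightarrow> complex) \<Rightarrow> (complex \<Rightarrow> complex) \<Rightarrow> 'h \<Rightarrow> 'h" where
  "joint f g x = E.\<Phi> f (F.\<Phi> g x)"

lemma joint_bounded_clinear:
  assumes "bounded_borel f" "bounded_borel g"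
  shows "bounded_clinear (joint f g)"
  using bounded_clinear_compose[OF E.Phi_bounded_clinear[OF assms(1)] F.Phi_bounded_clinear[OF assms(2)]]
  by (simp add: joint_def[abs_def])

lemma joint_mult:
  assumes "bounded_borel f" "bounded_borel g" "bounded_borel f'" "bounded_borel g'"
  shows "joint f g (joint f' g' x) = joint (\<lambda>z. f z * f' z) (\<lambda>z. g z * g' z) x"
proof -
  have "joint f g (joint f' g' x) = E.\<Phi> f (E.\<Phi> f' (F.\<Phi> g (F.\<Phi> g' x)))"
    using assms by (simp add: joint_def Phi_commute_Phi)
  then show ?thesis using assms by (simp add: E.Phi_mult F.Phi_mult joint_def)
qed

lemma joint_adjoint:
  assumes "bounded_borel f" "bounded_borel g"
  shows "adjoint_pair (joint f g) (joint (\<lambda>z. cnj (f z)) (\<lambda>z. cnj (g z)))"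
  using adjoint_pair_compose[OF E.Phi_adjoint[OF assms(1)] F.Phi_adjoint[OF assms(2)]]
  by (simp add: joint_def[abs_def] Phi_commute_Phi bounded_borel_cnj assms)

text \<open>
  The operator is the square of the selfadjoint operator obtained from the square roots of the two
  moduli.
\<close>

lemma joint_cmod_nonneg:
  assumes f: "bounded_borel f" and g: "bounded_borel g"
  shows "0 \<le> Re (cinner (joint (\<lambda>z. of_real (cmod (f z))) (\<lambda>z. of_real (cmod (g z))) x) x)"
proof -
  let ?f = "\<lambda>z. complex_of_real (sqrt (cmod (f z)))" and ?g = "\<lambda>z. complex_of_real (sqrt (cmod (g z)))"
  have bb: "bounded_borel ?f" "bounded_borel ?g" using f g by (simp_all add: bounded_borel_sqrt_cmod)
  have "joint ?f ?g (joint ?f ?g x) = joint (\<lambda>z. of_real (cmod (f z))) (\<lambda>z. of_real (cmod (g z))) x"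
    by (simp add: joint_mult bb flip: of_real_mult)
  moreover have "cinner (joint ?f ?g (joint ?f ?g x)) x = cinner (joint ?f ?g x) (joint ?f ?g x)"
    using adjoint_pairD[OF joint_adjoint[OF bb]] by simp
  ultimately show ?thesis using Re_cinner_self_nonneg by simp
qed

definition family :: "(complex \<Rightarrow> complex) \<Rightarrow> (complex \<Rightarrow> complex) \<Rightarrow> nat \<Rightarrow> 'h \<Rightarrow> 'h" where
  "family f g n = joint (cutoff f n) (cutoff g n)"

lemma family_mult:
  assumes "locally_bounded_borel f" "locally_bounded_borel g"
    "locally_bounded_borel f'" "locally_bounded_borel g'"
  shows "family f g m (family f' g' n x) =
    family (\<lambda>z. f z * f' z) (\<lambda>z. g z * g' z) (min m n) x"
  unfolding family_def
  using joint_mult[OF assms[THEN locally_bounded_borelD]] by (simp add: cutoff_mult)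

lemma family_adjoint:
  assumes "locally_bounded_borel f" "locally_bounded_borel g"
  shows "adjoint_pair (family f g n) (family (\<lambda>z. cnj (f z)) (\<lambda>z. cnj (g z)) n)"
  unfolding family_def
  using joint_adjoint[OF assms[THEN locally_bounded_borelD]] by (simp add: cutoff_cnj)

lemma locally_bounded_borel_one: "locally_bounded_borel (\<lambda>_. 1)"
  by (intro locally_bounded_borel_continuous continuous_intros)

lemma family_one: "family (\<lambda>_. 1) (\<lambda>_. 1) n x = E (cball 0 (real n)) (F (cball 0 (real n)) x)"
  by (simp add: family_def joint_def E.Phi_cutoff_one F.Phi_cutoff_one)

text \<open>
  All operators of the calculus are limits along the exhaustion by
  \<open>E (cball 0 n) F (cball 0 n)\<close>, which belongs to the constant function \<open>1\<close>.
\<close>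

sublocale exhaustion "family (\<lambda>_. 1) (\<lambda>_. 1)"
proof
  note one = locally_bounded_borel_one
  fix m n x
  have lin: "bounded_clinear (family (\<lambda>_. 1) (\<lambda>_. 1) n)"
    unfolding family_def by (intro joint_bounded_clinear locally_bounded_borelD one)
  have adj: "adjoint_pair (family (\<lambda>_. 1) (\<lambda>_. 1) n) (family (\<lambda>_. 1) (\<lambda>_. 1) n)"
    using family_adjoint[OF one one, of n] by simp
  show mult: "family (\<lambda>_. 1) (\<lambda>_. 1) m (family (\<lambda>_. 1) (\<lambda>_. 1) n x)
      = family (\<lambda>_. 1) (\<lambda>_. 1) (min m n) x" for m n x
    by (simp add: family_mult one)
  show "orthogonal_projection (family (\<lambda>_. 1) (\<lambda>_. 1) n)"
    unfolding orthogonal_projection_def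
    using bounded_clinear_add[OF lin] bounded_clinear_scaleC[OF lin] mult adjoint_pairD[OF adj] by simp
  show "(\<lambda>n. family (\<lambda>_. 1) (\<lambda>_. 1) n x) \<longlonglongrightarrow> x"
  proof -
    let ?K = "\<lambda>n. cball (0::complex) (real n)"
    have "(\<lambda>n. norm (F (?K n) x - x) + norm (E (?K n) x - x)) \<longlonglongrightarrow> 0 + 0"
      by (intro tendsto_add tendsto_norm_zero LIM_zero E.E_cball_tendsto F.E_cball_tendsto)
    then have lim: "(\<lambda>n. norm (F (?K n) x - x) + norm (E (?K n) x - x)) \<longlonglongrightarrow> 0" by simp
    have "norm (E (?K n) (F (?K n) x) - x) \<le> norm (F (?K n) x - x) + norm (E (?K n) x - x)" for n
    proof -
      have "E (?K n) (F (?K n) x) - x = E (?K n) (F (?K n) x - x) + (E (?K n) x - x)"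
        using bounded_clinear_diff[OF E.E_bounded_clinear] by simp
      also have "norm \<dots> \<le> norm (F (?K n) x - x) + norm (E (?K n) x - x)"
        by (intro norm_triangle_le add_right_mono E.E_norm_le) simp
      finally show ?thesis .
    qed
    then have "\<forall>\<^sub>F n in sequentially. norm (E (?K n) (F (?K n) x) - x)
        \<le> norm (F (?K n) x - x) + norm (E (?K n) x - x)" by (intro always_eventually allI)
    from Lim_null_comparison[OF this lim] have "(\<lambda>n. E (?K n) (F (?K n) x) - x) \<longlonglongrightarrow> 0" .
    then show ?thesis by (simp add: family_one LIM_zero_iff)
  qed
qed

lemma family_coherent:
  assumes "locally_bounded_borel f" "locally_bounded_borel g"
  shows "coherent (family f g)"
  unfolding coherent_def
proof (intro conjI allI)
  show "bounded_clinear (family f g n)" for n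
    unfolding family_def by (intro joint_bounded_clinear locally_bounded_borelD assms)
qed (simp_all add: family_mult assms locally_bounded_borel_one min.commute)

text \<open>
  For locally bounded \<open>f\<close> and \<open>g\<close> this is the possibly unbounded normal operator
  \<open>\<integral> f(z) g(w) d(E \<otimes> F)(z, w)\<close>. For the theorem \<open>f\<close> and
  \<open>g\<close> range over \<open>1\<close>, \<open>z\<close> and \<open>\<bar>z\<bar>\<close>.
\<close>

definition joint_operator :: "(complex \<Rightarrow> complex) \<Rightarrow> (complex \<Rightarrow> complex) \<Rightarrow> ('h \<rightharpoonup> 'h)" where
  "joint_operator f g = strong_limit (family f g)"

lemma joint_operator_product_closure:
  assumes "locally_bounded_borel f" "locally_bounded_borel g"
    "locally_bounded_borel f'" "locally_bounded_borel g'"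
  shows "closure (Map.graph (joint_operator f g \<circ>\<^sub>m joint_operator f' g')) =
    Map.graph (joint_operator (\<lambda>z. f z * f' z) (\<lambda>z. g z * g' z))"
  using strong_limit_product_closure[OF family_coherent[OF assms(1,2)] family_coherent[OF assms(3,4)]]
  by (simp add: joint_operator_def family_mult assms)

lemma joint_operator_normal:
  assumes "locally_bounded_borel f" "locally_bounded_borel g"
  shows "normal_operator (joint_operator f g)"
  unfolding joint_operator_def
proof (rule strong_limit_normal[OF family_coherent[OF assms] family_coherent family_adjoint[OF assms]])
  show lb: "locally_bounded_borel (\<lambda>z. cnj (f z))" "locally_bounded_borel (\<lambda>z. cnj (g z))"
    using assms by (simp_all add: locally_bounded_borel_cnj)
  show "family f g n (family (\<lambda>z. cnj (f z)) (\<lambda>z. cnj (g z)) n x) =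
      family (\<lambda>z. cnj (f z)) (\<lambda>z. cnj (g z)) n (family f g n x)" for n x
    by (simp add: family_mult assms lb mult.commute)
qed

lemma joint_operator_abs:
  assumes "locally_bounded_borel f" "locally_bounded_borel g"
  shows "abs_operator (joint_operator f g) =
    joint_operator (\<lambda>z. of_real (cmod (f z))) (\<lambda>z. of_real (cmod (g z)))"
  unfolding joint_operator_def
proof (rule abs_operator_strong_limit[OF family_coherent[OF assms] family_coherent
      family_adjoint[OF assms] family_coherent])
  let ?f = "\<lambda>z. complex_of_real (cmod (f z))" and ?g = "\<lambda>z. complex_of_real (cmod (g z))"
  show cnj: "locally_bounded_borel (\<lambda>z. cnj (f z))" "locally_bounded_borel (\<lambda>z. cnj (g z))"
    using assms by (simp_all add: locally_bounded_borel_cnj)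
  show cmod: "locally_bounded_borel ?f" "locally_bounded_borel ?g"
    using assms by (simp_all add: locally_bounded_borel_cmod)
  show "adjoint_pair (family ?f ?g n) (family ?f ?g n)" for n
    using family_adjoint[OF cmod, of n] by simp
  show "0 \<le> Re (cinner (family ?f ?g n x) x)" for n x
    using joint_cmod_nonneg[OF assms[THEN locally_bounded_borelD]]
    by (simp add: family_def cutoff_cmod[abs_def])
  have "?f z * ?f z = cnj (f z) * f z" "?g z * ?g z = cnj (g z) * g z" for z
    using complex_norm_square[of "f z"] complex_norm_square[of "g z"]
    by (simp_all add: power2_eq_square mult.commute)
  then show "family ?f ?g n (family ?f ?g n x) =
      family (\<lambda>z. cnj (f z)) (\<lambda>z. cnj (g z)) n (family f g n x)" for n x
    by (simp add: family_mult assms cnj cmod)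
qed

end

lemma commuting_pvms_swap: "commuting_pvms E F \<Longrightarrow> commuting_pvms F E"
  by (simp add: commuting_pvms_def commuting_pvms_axioms_def)

context commuting_pvms
begin

lemma joint_operator_left:
  assumes "is_spectral_measure A E" "linear_operator A" "densely_defined A"
  shows "A = joint_operator (\<lambda>z. z) (\<lambda>_. 1)"
proof -
  have ident: "locally_bounded_borel (\<lambda>z. z)"
    by (intro locally_bounded_borel_continuous continuous_intros)
  note one = locally_bounded_borel_one
  have fam: "family (\<lambda>z. z) (\<lambda>_. 1) = (\<lambda>n x. E.\<Phi> (cutoff (\<lambda>z. z) n) (F (cball 0 (real n)) x))"
    by (simp add: family_def[abs_def] joint_def[abs_def] F.Phi_cutoff_one)
  have "strong_limit (\<lambda>n. E.\<Phi> (cutoff (\<lambda>z. z) n)) =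
      strong_limit (\<lambda>n x. E.\<Phi> (cutoff (\<lambda>z. z) n) (F (cball 0 (real n)) x))"
  proof (rule strong_limit_refine[OF E.exhaustion_cball E.cutoff_coherent[OF ident] exhaustion_axioms])
    show "coherent (\<lambda>n x. E.\<Phi> (cutoff (\<lambda>z. z) n) (F (cball 0 (real n)) x))"
      using family_coherent[OF ident one] by (simp add: fam)
    show "E.\<Phi> (cutoff (\<lambda>z. z) n) (F (cball 0 (real n)) x) = F (cball 0 (real n)) (E.\<Phi> (cutoff (\<lambda>z. z) n) x)" for n x
      using Phi_commute_Phi[OF locally_bounded_borelD[OF ident] locally_bounded_borelD[OF one]]
      by (simp add: F.Phi_cutoff_one)
  qed (simp_all add: family_one F.E_cball_tendsto E_F_commute)
  then show ?thesis
    using E.spectral_strong_limit[OF assms] by (simp add: joint_operator_def fam)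
qed

text \<open>
  The symmetric statement, obtained by exchanging the two measures; the order of the bounded factors
  is irrelevant since they commute.
\<close>

lemma joint_operator_right:
  assumes "is_spectral_measure B F" "linear_operator B" "densely_defined B"
  shows "B = joint_operator (\<lambda>_. 1) (\<lambda>z. z)"
proof -
  interpret swap: commuting_pvms F E by (rule commuting_pvms_swap) (rule commuting_pvms_axioms)
  have ident: "locally_bounded_borel (\<lambda>z. z)"
    by (intro locally_bounded_borel_continuous continuous_intros)
  have "swap.family (\<lambda>z. z) (\<lambda>_. 1) = family (\<lambda>_. 1) (\<lambda>z. z)"
    by (simp add: fun_eq_iff family_def swap.family_def joint_def swap.joint_def Phi_commute_Phi
        locally_bounded_borelD ident locally_bounded_borel_one)
  then show ?thesis
    using swap.joint_operator_left[OF assms] by (simp add: joint_operator_def swap.joint_operator_def)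
qed

end

theorem proposition2p10:
  fixes A B :: "'h::complex_hilbert_space \<rightharpoonup> 'h"
  assumes "normal_operator A" and "normal_operator B" and "strongly_commute A B"
  shows "closable (A \<circ>\<^sub>m B) \<and> closable (B \<circ>\<^sub>m A) \<and>
         closable (abs_operator A \<circ>\<^sub>m abs_operator B) \<and>
         closable (abs_operator B \<circ>\<^sub>m abs_operator A) \<and>
         operator_closure (A \<circ>\<^sub>m B) = operator_closure (B \<circ>\<^sub>m A) \<and>
         normal_operator (operator_closure (A \<circ>\<^sub>m B)) \<and>
         abs_operator (operator_closure (B \<circ>\<^sub>m A)) = abs_operator (operator_closure (A \<circ>\<^sub>m B)) \<and>
         abs_operator (operator_closure (A \<circ>\<^sub>m B)) =
           operator_closure (abs_operator A \<circ>\<^sub>m abs_operator B) \<and>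
         operator_closure (abs_operator A \<circ>\<^sub>m abs_operator B) =
           operator_closure (abs_operator B \<circ>\<^sub>m abs_operator A)"
proof -
  obtain E F where spec: "is_spectral_measure A E" "is_spectral_measure B F"
    and comm: "\<forall>M \<in> sets borel. \<forall>N \<in> sets borel. E M \<circ> F N = F N \<circ> E M"
    using assms(3) unfolding strongly_commute_def by blast
  interpret commuting_pvms E F
  proof
    show "projection_valued_measure E" "projection_valued_measure F"
      using spec by (simp_all add: is_spectral_measure_def)
    show "E M (F N x) = F N (E M x)" if "M \<in> sets borel" "N \<in> sets borel" for M N x
      using comm that by (metis comp_apply)
  qed
  let ?one = "\<lambda>_::complex. 1 :: complex" and ?id = "\<lambda>z::complex. z" and ?abs = "\<lambda>z. complex_of_real (cmod z)"
  have lb: "locally_bounded_borel ?one" "locally_bounded_borel ?id" "locally_bounded_borel ?abs"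
    by (intro locally_bounded_borel_continuous continuous_intros)+
  have A: "A = joint_operator ?id ?one"
    using assms(1) by (intro joint_operator_left spec) (simp_all add: normal_operator_def)
  have B: "B = joint_operator ?one ?id"
    using assms(2) by (intro joint_operator_right spec) (simp_all add: normal_operator_def)
  have absA: "abs_operator A = joint_operator ?abs ?one"
    using joint_operator_abs[OF lb(2,1)] by (simp add: A)
  have absB: "abs_operator B = joint_operator ?one ?abs"
    using joint_operator_abs[OF lb(1,2)] by (simp add: B)
  have AB: "closure (Map.graph (A \<circ>\<^sub>m B)) = Map.graph (joint_operator ?id ?id)"
    using joint_operator_product_closure[OF lb(2,1,1,2)] by (simp add: A B)
  have BA: "closure (Map.graph (B \<circ>\<^sub>m A)) = Map.graph (joint_operator ?id ?id)"
    using joint_operator_product_closure[OF lb(1,2,2,1)] by (simp add: A B)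
  have absAB: "closure (Map.graph (abs_operator A \<circ>\<^sub>m abs_operator B)) = Map.graph (joint_operator ?abs ?abs)"
    using joint_operator_product_closure[OF lb(3,1,1,3)] by (simp add: absA absB)
  have absBA: "closure (Map.graph (abs_operator B \<circ>\<^sub>m abs_operator A)) = Map.graph (joint_operator ?abs ?abs)"
    using joint_operator_product_closure[OF lb(1,3,3,1)] by (simp add: absA absB)
  show ?thesis
    using joint_operator_normal[OF lb(2,2)] joint_operator_abs[OF lb(2,2)]
    by (simp add: closure_graph_imp[OF AB] closure_graph_imp[OF BA]
        closure_graph_imp[OF absAB] closure_graph_imp[OF absBA])
qed

end
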